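(* Let $(\mathcal H,[\cdot,\cdot])$ be a Krein space, let $B\in CR(\mathcal H)$ and $C\in L(\mathcal H)$. Then there exists an indefinite min-max solution (ImMS) of $BX-C=0$ if and only if $R(C)\subseteq R(B)+R(B)^{[\perp]}$.
   Context: A Krein space is a complex vector space $\mathcal H$ with a Hermitian sesquilinear form $[\cdot,\cdot]$ admitting a fundamental decomposition $\mathcal H=\mathcal H_+[\dotplus]\mathcal H_-$ (direct and $[\cdot,\cdot]$-orthogonal) with $(\mathcal H_+,[\cdot,\cdot])$ and $(\mathcal H_-,-[\cdot,\cdot])$ (separable) Hilbert spaces; the direct sum of these Hilbert spaces gives a Hilbert space inner product $\langle\cdot,\cdot\rangle$ on $\mathcal H$ depending on the decomposition, and the resulting norms are all equivalent. $L(\mathcal H)$ is the space of linear operators on $\mathcal H$ bounded with respect to such a norm; $CR(\mathcal H)$ is the set of those with closed range. $R(A)$ is the range of $A$. For $T\in L(\mathcal H)$, $T^{\#}$ is the unique operator with $[Tx,y]=[x,T^{\#}y]$ for all $x,y$. For a subspace $\mathcal S$, $\mathcal S^{[\perp]}=\{x\in\mathcal H:[x,s]=0\ \forall s\in\mathcal S\}$. For $S,T\in L(\mathcal H)$, $S\le T$ means $[(T-S)x,x]\ge 0$ for all $x\in\mathcal H$; minima and maxima are taken in this order and are required to be attained. A subspace $\mathcal S$ is positive if $[s,s]>0$ for all nonzero $s\in\mathcal S$, and nonpositive if $[s,s]\le 0$ for all $s\in\mathcal S$. Fix a fundamental decomposition of $\mathcal H$ with inner product $\langle\cdot,\cdot\rangle$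 (the notion of ImMS below does not depend on this choice). It is known that the closed subspace $R(B)$ can be written uniquely as $R(B)=\mathcal S_+[\dotplus]\mathcal S_-$ (direct and $[\cdot,\cdot]$-orthogonal) with $\mathcal S_+$ a closed positive subspace, $\mathcal S_-$ a closed nonpositive subspace and $\langle\mathcal S_+,\mathcal S_-\rangle=\{0\}$. Let $P_\pm$ be the $\langle\cdot,\cdot\rangle$-orthogonal projections onto $\mathcal S_\pm$ and set $B_\pm:=P_\pm B$, so that $B=B_++B_-$ and $R(B_\pm)=\mathcal S_\pm$. An operator $Z_0\in L(\mathcal H)$ is an indefinite min-max solution (ImMS) of $BX-C=0$ if $$(BZ_0-C)^{\#}(BZ_0-C)=\max_{Y\in L(\mathcal H)}\ \min_{X\in L(\mathcal H)}(B_+X+B_-Y-C)^{\#}(B_+X+B_-Y-C)$$ (in particular, the minimum over $X$ exists for every $Y$, and the maximum over $Y$ of these minima exists). *)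

theory Defs
  imports "HOL-Analysis.Analysis" "HOL-Library.Complex_Order" "HOL-Library.Set_Algebras"
begin

text \<open>
  The underlying complex vector space is the whole type \<open>'a\<close>, with an explicit scalar
  multiplication.  Sesquilinear forms are linear in the first argument.  The order on
  complex numbers is that of \<^theory>\<open>HOL-Library.Complex_Order\<close>: \<open>0 \<le> z\<close> says that \<open>z\<close> is real
  and nonnegative.
\<close>

text \<open>The modulus makes this a nonnegative symmetric function on the whole type even where \<open>f\<close> is
  not positive; where \<open>f\<close> is positive, it is the usual distance of the inner product \<open>f\<close>.\<close>

definition form_dist :: "('a::ab_group_add \<Rightarrow> 'a \<Rightarrow> complex) \<Rightarrow> 'a \<Rightarrow> 'a \<Rightarrow> real" where
  "form_dist f x y = sqrt (cmod (f (x - y) (x - y)))"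

definition direct_sum :: "'a::ab_group_add set \<Rightarrow> 'a set \<Rightarrow> 'a set \<Rightarrow> bool" where
  "direct_sum S M N \<longleftrightarrow> M + N = S \<and> M \<inter> N = {0}"

definition orthogonal_sets :: "('a \<Rightarrow> 'a \<Rightarrow> complex) \<Rightarrow> 'a set \<Rightarrow> 'a set \<Rightarrow> bool" where
  "orthogonal_sets f M N \<longleftrightarrow> (\<forall>x\<in>M. \<forall>y\<in>N. f x y = 0)"

locale hermitian_form = vector_space scale
  for scale :: "complex \<Rightarrow> 'a::ab_group_add \<Rightarrow> 'a" (infixr \<open>*s\<close> 75) +
  fixes ip :: "'a \<Rightarrow> 'a \<Rightarrow> complex"
  assumes ip_add_left: "ip (x + y) z = ip x z + ip y z"
    and ip_scale_left: "ip (c *s x) y = c * ip x y"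
    and ip_hermitian: "ip y x = cnj (ip x y)"
begin

text \<open>\<open>f\<close> will be \<open>ip\<close> or its negative, so its sesquilinearity need not be repeated.
  Hilbert spaces are separable by convention.\<close>

definition hilbert_subspace :: "('a \<Rightarrow> 'a \<Rightarrow> complex) \<Rightarrow> 'a set \<Rightarrow> bool" where
  "hilbert_subspace f S \<longleftrightarrow>
     subspace S \<and> (\<forall>x\<in>S. x \<noteq> 0 \<longrightarrow> 0 < f x x) \<and>
     Metric_space.mcomplete S (form_dist f) \<and>
     separable_space (Metric_space.mtopology S (form_dist f))"

definition fundamental_decomposition :: "'a set \<Rightarrow> 'a set \<Rightarrow> bool" where
  "fundamental_decomposition Hp Hm \<longleftrightarrow>
     direct_sum UNIV Hp Hm \<and> orthogonal_sets ip Hp Hm \<and>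
     hilbert_subspace ip Hp \<and> hilbert_subspace (\<lambda>x y. - ip x y) Hm"

definition orth_companion :: "'a set \<Rightarrow> 'a set" where
  "orth_companion S = {x. \<forall>s\<in>S. ip x s = 0}"

definition positive_subspace :: "'a set \<Rightarrow> bool" where
  "positive_subspace S \<longleftrightarrow> subspace S \<and> (\<forall>s\<in>S. s \<noteq> 0 \<longrightarrow> 0 < ip s s)"

definition nonpositive_subspace :: "'a set \<Rightarrow> bool" where
  "nonpositive_subspace S \<longleftrightarrow> subspace S \<and> (\<forall>s\<in>S. ip s s \<le> 0)"

definition op_le :: "('a \<Rightarrow> 'a) \<Rightarrow> ('a \<Rightarrow> 'a) \<Rightarrow> bool" where
  "op_le S T \<longleftrightarrow> (\<forall>x. 0 \<le> ip (T x - S x) x)"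

definition is_op_min :: "('a \<Rightarrow> 'a) set \<Rightarrow> ('a \<Rightarrow> 'a) \<Rightarrow> bool" where
  "is_op_min A M \<longleftrightarrow> M \<in> A \<and> (\<forall>T\<in>A. op_le M T)"

definition is_op_max :: "('a \<Rightarrow> 'a) set \<Rightarrow> ('a \<Rightarrow> 'a) \<Rightarrow> bool" where
  "is_op_max A M \<longleftrightarrow> M \<in> A \<and> (\<forall>T\<in>A. op_le T M)"

end

locale krein_space = hermitian_form scale ip
  for scale :: "complex \<Rightarrow> 'a::ab_group_add \<Rightarrow> 'a" (infixr \<open>*s\<close> 75)
  and ip :: "'a \<Rightarrow> 'a \<Rightarrow> complex" +
  assumes ex_fundamental_decomposition: "\<exists>Hp Hm. fundamental_decomposition Hp Hm"

locale decomposed_krein_space = krein_space scale ip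
  for scale :: "complex \<Rightarrow> 'a::ab_group_add \<Rightarrow> 'a" (infixr \<open>*s\<close> 75)
  and ip :: "'a \<Rightarrow> 'a \<Rightarrow> complex" +
  fixes Hp Hm :: "'a set"
  assumes fundamental_decomposition: "fundamental_decomposition Hp Hm"
begin

definition pos_part :: "'a \<Rightarrow> 'a" where
  "pos_part x = (THE p. p \<in> Hp \<and> x - p \<in> Hm)"

definition neg_part :: "'a \<Rightarrow> 'a" where
  "neg_part x = x - pos_part x"

text \<open>The Hilbert space inner product induced by the fundamental decomposition.\<close>

definition hip :: "'a \<Rightarrow> 'a \<Rightarrow> complex" where
  "hip x y = ip (pos_part x) (pos_part y) - ip (neg_part x) (neg_part y)"

definition hnorm :: "'a \<Rightarrow> real" where
  "hnorm x = form_dist hip x 0"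

definition closed_set :: "'a set \<Rightarrow> bool" where
  "closed_set S \<longleftrightarrow> closedin (Metric_space.mtopology UNIV (form_dist hip)) S"

definition bounded_ops :: "('a \<Rightarrow> 'a) set" where
  "bounded_ops = {T. Vector_Spaces.linear scale scale T \<and> (\<exists>K. \<forall>x. hnorm (T x) \<le> K * hnorm x)}"

definition closed_range_ops :: "('a \<Rightarrow> 'a) set" where
  "closed_range_ops = {T \<in> bounded_ops. closed_set (range T)}"

definition adj :: "('a \<Rightarrow> 'a) \<Rightarrow> 'a \<Rightarrow> 'a" where
  "adj T = (THE S. S \<in> bounded_ops \<and> (\<forall>x y. ip (T x) y = ip x (S y)))"

definition orth_proj :: "'a set \<Rightarrow> 'a \<Rightarrow> 'a" where
  "orth_proj S x = (THE p. p \<in> S \<and> (\<forall>s\<in>S. hip (x - p) s = 0))"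

definition sign_decomposition :: "'a set \<Rightarrow> 'a set \<Rightarrow> 'a set \<Rightarrow> bool" where
  "sign_decomposition R Sp Sm \<longleftrightarrow>
     direct_sum R Sp Sm \<and> orthogonal_sets ip Sp Sm \<and> orthogonal_sets hip Sp Sm \<and>
     closed_set Sp \<and> positive_subspace Sp \<and> closed_set Sm \<and> nonpositive_subspace Sm"

definition gram :: "('a \<Rightarrow> 'a) \<Rightarrow> 'a \<Rightarrow> 'a" where
  "gram T = adj T \<circ> T"

definition residual :: "('a \<Rightarrow> 'a) \<Rightarrow> ('a \<Rightarrow> 'a) \<Rightarrow> ('a \<Rightarrow> 'a) \<Rightarrow> ('a \<Rightarrow> 'a) \<Rightarrow> ('a \<Rightarrow> 'a) \<Rightarrow> 'a \<Rightarrow> 'a" where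
  "residual Bp Bm C X Y = (\<lambda>x. Bp (X x) + Bm (Y x) - C x)"

text \<open>The sign decomposition \<open>Sp, Sm\<close> of the closed range of \<open>B\<close> is unique, so the existential
  quantifier over it only names it.  Minima are unique because the order is antisymmetric on
  linear operators; \<open>m Y\<close> is the minimum over \<open>X\<close>, required to exist for every \<open>Y\<close>.\<close>

definition is_ImMS :: "('a \<Rightarrow> 'a) \<Rightarrow> ('a \<Rightarrow> 'a) \<Rightarrow> ('a \<Rightarrow> 'a) \<Rightarrow> bool" where
  "is_ImMS B C Z \<longleftrightarrow> Z \<in> bounded_ops \<and>
     (\<exists>Sp Sm m. sign_decomposition (range B) Sp Sm \<and>
        (\<forall>Y\<in>bounded_ops. is_op_min
           ((\<lambda>X. gram (residual (orth_proj Sp \<circ> B) (orth_proj Sm \<circ> B) C X Y)) ` bounded_ops) (m Y)) \<and>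
        is_op_max (m ` bounded_ops) (gram (\<lambda>x. B (Z x) - C x)))"

end

end

theory Submission
  imports Defs
begin

text \<open>
  Write \<open>R(B) = S\<^sub>+ + S\<^sub>-\<close>. Rank-one perturbations of \<open>X\<close> move \<open>B\<^sub>+ X x\<close> in every direction of
  \<open>S\<^sub>+\<close>, so the inner minimum is attained exactly when the residual is \<open>[\<cdot>,\<cdot>]\<close>-orthogonal to \<open>S\<^sub>+\<close>;
  as \<open>[S\<^sub>+, S\<^sub>-] = 0\<close> and \<open>S\<^sub>+\<close> is positive, the optimal \<open>B\<^sub>+ X\<close> does not depend on \<open>Y\<close>. Then the outer
  maximum is attained exactly when the residual is also orthogonal to \<open>S\<^sub>-\<close>. Hence an ImMS exists iff
  \<open>B\<^sup># (B Z - C) = 0\<close> has a bounded solution \<open>Z\<close>, which by Douglas' factorization theorem means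
  \<open>R(B\<^sup># C) \<subseteq> R(B\<^sup># B)\<close>, that is, \<open>R(C)\<close> lies in the sum of \<open>R(B)\<close> and its orthogonal companion.
  The sign decomposition is the spectral decomposition of the compression of the fundamental
  symmetry to \<open>R(B)\<close>, obtained from a square root instead of the spectral theorem.
\<close>

subsection \<open>Inner products\<close>

no_notation vector_scalar_mult (infixl "*s" 70)

text \<open>For small \<open>c\<close> the linear term dominates, so a nonzero \<open>z\<close>
  would allow a negative value. The first-order conditions below are all reduced to this;
  \<open>b\<close> may have either sign.\<close>

lemma quadratic_nonneg_imp_zero:
  fixes z :: complex
  assumes "\<And>c. 0 \<le> 2 * Re (cnj c * z) + (cmod c)\<^sup>2 * b"
  shows "z = 0"
proof (rule ccontr)
  assume "z \<noteq> 0"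
  \<comment> \<open>The test value is \<open>c = - t * z\<close>. It gives the square of
    \<open>cmod z\<close> times \<open>t * (t * b - 2)\<close>, and this \<open>t\<close> keeps
    \<open>t * b\<close> below 2 for every real \<open>b\<close>.\<close>
  define t where "t = 1 / (\<bar>b\<bar> + 1)"
  have t: "0 < t" "t * b < 2"
    unfolding t_def by (auto simp: field_simps)
  have "0 \<le> 2 * Re (cnj (- (of_real t * z)) * z) + (cmod (- (of_real t * z)))\<^sup>2 * b"
    by (rule assms)
  also have "\<dots> = (cmod z)\<^sup>2 * t * (t * b - 2)"
    using t by (simp add: norm_mult power_mult_distrib cmod_power2) (simp add: algebra_simps power2_eq_square)
  also have "\<dots> < 0"
    using t \<open>z \<noteq> 0\<close> by (intro mult_pos_neg) auto
  finally show False by simp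
qed

context hermitian_form
begin

lemma ip_add_right: "ip x (y + z) = ip x y + ip x z"
  by (metis complex_cnj_add ip_add_left ip_hermitian)

lemma ip_scale_right: "ip x (c *s y) = cnj c * ip x y"
  by (metis complex_cnj_mult ip_hermitian ip_scale_left)

lemma ip_zero_left [simp]: "ip 0 x = 0"
  using ip_add_left[of 0 0 x] by simp

lemma ip_zero_right [simp]: "ip x 0 = 0"
  using ip_add_right[of x 0 0] by simp

lemma ip_minus_left [simp]: "ip (- x) y = - ip x y"
  using ip_add_left[of x "- x" y] by (simp add: eq_neg_iff_add_eq_0 add.commute)

lemma ip_minus_right [simp]: "ip x (- y) = - ip x y"
  using ip_add_right[of x y "- y"] by (simp add: eq_neg_iff_add_eq_0 add.commute)

lemma ip_diff_left: "ip (x - y) z = ip x z - ip y z"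
  using ip_add_left[of x "- y" z] by simp

lemma ip_diff_right: "ip x (y - z) = ip x y - ip x z"
  using ip_add_right[of x y "- z"] by simp

lemmas ip_simps = ip_add_left ip_add_right ip_diff_left ip_diff_right ip_scale_left ip_scale_right

lemma ip_self_real: "ip x x = complex_of_real (Re (ip x x))"
  using ip_hermitian[of x x] by (metis Reals_cnj_iff of_real_Re)

lemma ip_eq_0_commute: "ip x y = 0 \<longleftrightarrow> ip y x = 0"
  by (metis complex_cnj_zero ip_hermitian)

lemma Re_ip_add_self: "Re (ip (x + y) (x + y)) = Re (ip x x) + 2 * Re (ip x y) + Re (ip y y)"
  using ip_hermitian[of x y] by (simp add: ip_simps)

lemma Re_ip_scale_self: "Re (ip (c *s x) (c *s x)) = (cmod c)\<^sup>2 * Re (ip x x)"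
proof -
  have "ip (c *s x) (c *s x) = complex_of_real ((cmod c)\<^sup>2) * ip x x"
    by (simp add: ip_simps complex_norm_square mult_ac flip: of_real_power)
  then show ?thesis by simp
qed

text \<open>First variation: along \<open>x + c *s v\<close> the value changes by
  \<open>2 * Re (cnj c * ip x v)\<close> plus a term of second order in \<open>c\<close>. The form
  may be indefinite.\<close>

lemma ip_zero_if_minimal:
  assumes "\<And>c. Re (ip x x) \<le> Re (ip (x + c *s v) (x + c *s v))"
  shows "ip x v = 0"
proof (rule quadratic_nonneg_imp_zero)
  fix c
  show "0 \<le> 2 * Re (cnj c * ip x v) + (cmod c)\<^sup>2 * Re (ip v v)"
    using assms[of c] by (simp add: Re_ip_add_self Re_ip_scale_self ip_scale_right[of x])
qed

lemma ip_zero_if_maximal: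
  assumes "\<And>c. Re (ip (x + c *s v) (x + c *s v)) \<le> Re (ip x x)"
  shows "ip x v = 0"
proof -
  \<comment> \<open>Maximality for \<open>ip\<close> is minimality for its negative, so the same
    quadratic argument applies to \<open>- ip x v\<close>.\<close>
  have "- ip x v = 0"
  proof (rule quadratic_nonneg_imp_zero)
    fix c
    show "0 \<le> 2 * Re (cnj c * (- ip x v)) + (cmod c)\<^sup>2 * (- Re (ip v v))"
      using assms[of c] by (simp add: Re_ip_add_self Re_ip_scale_self ip_scale_right[of x])
  qed
  then show ?thesis by simp
qed

lemma linear_iff_additive_homogeneous:
  "Vector_Spaces.linear scale scale T \<longleftrightarrow>
    (\<forall>x y. T (x + y) = T x + T y) \<and> (\<forall>c x. T (c *s x) = c *s T x)"
  using vector_space_axioms by (auto simp: Vector_Spaces.linear_iff)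

end

locale inner_form = hermitian_form +
  assumes ip_pos: "x \<noteq> 0 \<Longrightarrow> 0 < ip x x"
begin

text \<open>Phrased through \<open>form_dist\<close> so that it coincides with \<open>hnorm\<close>
  once the form is \<open>hip\<close>.\<close>

definition nrm :: "'a \<Rightarrow> real" where
  "nrm x = form_dist ip x 0"

lemma nrm_nonneg [simp]: "0 \<le> nrm x"
  by (simp add: nrm_def form_dist_def)

lemma ip_self: "ip x x = complex_of_real ((nrm x)\<^sup>2)"
proof -
  have "0 \<le> ip x x" using ip_pos[of x] by (cases "x = 0") auto
  then show ?thesis unfolding nrm_def form_dist_def
    by (simp add: less_eq_complex_def complex_eq_iff cmod_def)
qed

lemma Re_ip_self: "Re (ip x x) = (nrm x)\<^sup>2"
  by (simp add: ip_self)

lemma nrm_eq_0_iff [simp]: "nrm x = 0 \<longleftrightarrow> x = 0"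
  using ip_self[of x] ip_pos[of x] by (cases "x = 0") auto

lemma nrm_0 [simp]: "nrm 0 = 0"
  by simp

lemma nrm_scale: "nrm (c *s x) = cmod c * nrm x"
proof -
  have "(nrm (c *s x))\<^sup>2 = (cmod c * nrm x)\<^sup>2"
    using Re_ip_scale_self[of c x] by (simp add: Re_ip_self power_mult_distrib)
  then show ?thesis by simp
qed

lemma nrm_minus [simp]: "nrm (- x) = nrm x"
  using Re_ip_self[of "- x"] Re_ip_self[of x] by simp

lemma nrm_minus_commute: "nrm (x - y) = nrm (y - x)"
  by (metis minus_diff_eq nrm_minus)

lemma nrm_add_square: "(nrm (x + y))\<^sup>2 = (nrm x)\<^sup>2 + 2 * Re (ip x y) + (nrm y)\<^sup>2"
  using Re_ip_add_self[of x y] by (simp add: Re_ip_self)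

lemma nrm_diff_square: "(nrm (x - y))\<^sup>2 = (nrm x)\<^sup>2 - 2 * Re (ip x y) + (nrm y)\<^sup>2"
  using nrm_add_square[of x "- y"] by simp

lemma cauchy_schwarz: "cmod (ip x y) \<le> nrm x * nrm y"
proof (cases "y = 0")
  case False
  define b where "b = (nrm y)\<^sup>2"
  have b: "b > 0" using False by (simp add: b_def)
  \<comment> \<open>This \<open>c\<close> minimises \<open>nrm (x + c *s y)\<close>: it removes the
    component of \<open>x\<close> along \<open>y\<close>.\<close>
  define c where "c = - (ip x y) / b"
  have "0 \<le> (nrm (x + c *s y))\<^sup>2" by simp
  also have "\<dots> = (nrm x)\<^sup>2 + 2 * Re (cnj c * ip x y) + (cmod c)\<^sup>2 * b"
    by (simp add: nrm_add_square nrm_scale ip_simps b_def power_mult_distrib)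
  also have "\<dots> = (nrm x)\<^sup>2 - (cmod (ip x y))\<^sup>2 / b"
    using b unfolding c_def
    by (simp add: norm_divide power_divide cmod_power2) (simp add: field_simps power2_eq_square)
  finally have "(cmod (ip x y))\<^sup>2 \<le> (nrm x * nrm y)\<^sup>2"
    using b by (simp add: field_simps b_def)
  then show ?thesis by (simp add: power2_le_iff_abs_le)
qed simp

lemma nrm_triangle: "nrm (x + y) \<le> nrm x + nrm y"
proof -
  have "Re (ip x y) \<le> nrm x * nrm y"
    using cauchy_schwarz[of x y] complex_Re_le_cmod[of "ip x y"] by linarith
  then have "(nrm (x + y))\<^sup>2 \<le> (nrm x + nrm y)\<^sup>2"
    by (simp add: nrm_add_square power2_sum)
  then show ?thesis by (rule power2_le_imp_le) simp
qed

lemma nrm_triangle_diff: "nrm (x - z) \<le> nrm (x - y) + nrm (y - z)"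
  using nrm_triangle[of "x - y" "y - z"] by simp

lemma form_dist_eq_nrm: "form_dist ip x y = nrm (x - y)"
  by (simp add: nrm_def form_dist_def)

sublocale metric: Metric_space UNIV "form_dist ip"
  by unfold_locales (auto simp: form_dist_eq_nrm nrm_minus_commute nrm_triangle_diff)

lemma ip_eq_imp_eq: "(\<And>z. ip x z = ip y z) \<Longrightarrow> x = y"
  using ip_pos[of "x - y"] by (auto simp: ip_diff_left)

section \<open>Sequential convergence in norm\<close>

definition converges :: "(nat \<Rightarrow> 'a) \<Rightarrow> 'a \<Rightarrow> bool" where
  "converges X l \<longleftrightarrow> (\<lambda>n. nrm (X n - l)) \<longlonglongrightarrow> 0"

lemma limitin_iff_converges: "limitin metric.mtopology X l sequentially \<longleftrightarrow> converges X l"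
  by (simp add: metric.limitin_metric_dist_null form_dist_eq_nrm converges_def)

lemma closedin_iff_sequential:
  "closedin metric.mtopology S \<longleftrightarrow> (\<forall>X l. (\<forall>n. X n \<in> S) \<longrightarrow> converges X l \<longrightarrow> l \<in> S)"
  by (auto simp: metric.metric_closedin_iff_sequentially_closed limitin_iff_converges image_subset_iff)

lemma closedinD:
  "closedin metric.mtopology S \<Longrightarrow> (\<And>n. X n \<in> S) \<Longrightarrow> converges X l \<Longrightarrow> l \<in> S"
  using closedin_iff_sequential by blast

lemma converges_const: "converges (\<lambda>n. x) x"
  by (simp add: converges_def)

lemma converges_add: "converges X x \<Longrightarrow> converges Y y \<Longrightarrow> converges (\<lambda>n. X n + Y n) (x + y)"
  unfolding converges_def
  by (rule tendsto_sandwich[where f = "\<lambda>_. 0" and h = "\<lambda>n. nrm (X n - x) + nrm (Y n - y)"])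
    (use nrm_triangle[of "X _ - x" "Y _ - y"] in
      \<open>auto intro!: always_eventually tendsto_eq_intros simp: algebra_simps\<close>)

lemma converges_bounded:
  assumes X: "converges X x" and T: "\<And>n. nrm (Y n - y) \<le> K * nrm (X n - x)"
  shows "converges Y y"
  unfolding converges_def
  by (rule tendsto_sandwich[where f = "\<lambda>_. 0" and h = "\<lambda>n. K * nrm (X n - x)"])
    (use T X in \<open>auto simp: converges_def intro!: tendsto_eq_intros\<close>)

lemma converges_scale: "converges X x \<Longrightarrow> converges (\<lambda>n. c *s X n) (c *s x)"
  by (erule converges_bounded[where K = "cmod c"]) (simp flip: scale_right_diff_distrib add: nrm_scale)

lemma converges_unique:
  assumes "converges X x" "converges X y" shows "x = y"
  using assms metric.limitin_metric_unique[of X _ sequentially] trivial_limit_sequentially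
  unfolding limitin_iff_converges[symmetric] by blast

lemma tendsto_ip_left: "converges X x \<Longrightarrow> (\<lambda>n. ip (X n) y) \<longlonglongrightarrow> ip x y"
  unfolding converges_def
  by (rule Lim_null[THEN iffD2],
      rule Lim_null_comparison[where g = "\<lambda>n. nrm (X n - x) * nrm y"])
    (auto simp: cauchy_schwarz simp flip: ip_diff_left intro!: tendsto_eq_intros always_eventually)

lemma tendsto_ip_right: "converges X x \<Longrightarrow> (\<lambda>n. ip y (X n)) \<longlonglongrightarrow> ip y x"
  using tendsto_cnj[OF tendsto_ip_left[of X x y]] by (simp flip: ip_hermitian)

lemma tendsto_nrm:
  assumes "converges X x" shows "(\<lambda>n. nrm (X n)) \<longlonglongrightarrow> nrm x"
proof (rule Lim_null[THEN iffD2], rule Lim_null_comparison)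
  have "\<bar>nrm (X n) - nrm x\<bar> \<le> nrm (X n - x)" for n
    using nrm_triangle[of "X n - x" x] nrm_triangle[of "x - X n" "X n"]
    by (simp add: nrm_minus_commute)
  then show "\<forall>\<^sub>F n in sequentially. norm (nrm (X n) - nrm x) \<le> nrm (X n - x)"
    by simp
qed (use assms in \<open>simp add: converges_def\<close>)

section \<open>Bounded linear operators\<close>

definition bops :: "('a \<Rightarrow> 'a) set" where
  "bops = {T. Vector_Spaces.linear scale scale T \<and> (\<exists>K. \<forall>x. nrm (T x) \<le> K * nrm x)}"

lemma bopsI:
  assumes "\<And>x y. T (x + y) = T x + T y" "\<And>c x. T (c *s x) = c *s T x"
    and "\<And>x. nrm (T x) \<le> K * nrm x"
  shows "T \<in> bops"
  using assms unfolding bops_def linear_iff_additive_homogeneous by blast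

lemma bops_add: "T \<in> bops \<Longrightarrow> T (x + y) = T x + T y"
  by (simp add: bops_def linear_iff_additive_homogeneous)

lemma bops_scale: "T \<in> bops \<Longrightarrow> T (c *s x) = c *s T x"
  by (simp add: bops_def linear_iff_additive_homogeneous)

lemma bops_zero [simp]: "T \<in> bops \<Longrightarrow> T 0 = 0"
  using bops_scale[of T 0 0] by simp

lemma bops_minus: "T \<in> bops \<Longrightarrow> T (- x) = - T x"
  using bops_scale[of T "- 1" x] by simp

lemma bops_diff: "T \<in> bops \<Longrightarrow> T (x - y) = T x - T y"
  using bops_add[of T x "- y"] bops_minus[of T y] by simp

lemma bops_bound:
  assumes "T \<in> bops" obtains K where "K > 0" "\<And>x. nrm (T x) \<le> K * nrm x"
proof -
  obtain K where K: "\<And>x. nrm (T x) \<le> K * nrm x" using assms by (auto simp: bops_def)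
  have "nrm (T x) \<le> (\<bar>K\<bar> + 1) * nrm x" for x
    by (rule order_trans[OF K mult_right_mono]) auto
  then show thesis using that[of "\<bar>K\<bar> + 1"] by simp
qed

lemma bops_converges: "T \<in> bops \<Longrightarrow> converges X x \<Longrightarrow> converges (\<lambda>n. T (X n)) (T x)"
  by (rule bops_bound, assumption, erule converges_bounded) (simp flip: bops_diff)

lemma bops_compose:
  assumes S: "S \<in> bops" and T: "T \<in> bops" shows "(\<lambda>x. S (T x)) \<in> bops"
proof -
  obtain K where K: "K > 0" "\<And>x. nrm (S x) \<le> K * nrm x" using bops_bound[OF S] by blast
  obtain L where L: "L > 0" "\<And>x. nrm (T x) \<le> L * nrm x" using bops_bound[OF T] by blast
  have "nrm (S (T x)) \<le> K * L * nrm x" for x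
    using order_trans[OF K(2)[of "T x"] mult_left_mono[OF L(2)[of x], of K]] K(1)
    by (simp add: mult.assoc)
  then show ?thesis
    using S T by (intro bopsI) (auto simp: bops_add bops_scale)
qed

lemma bops_sum:
  assumes S: "S \<in> bops" and T: "T \<in> bops" shows "(\<lambda>x. S x + T x) \<in> bops"
proof -
  obtain K where K: "K > 0" "\<And>x. nrm (S x) \<le> K * nrm x" using bops_bound[OF S] by blast
  obtain L where L: "L > 0" "\<And>x. nrm (T x) \<le> L * nrm x" using bops_bound[OF T] by blast
  have "nrm (S x + T x) \<le> (K + L) * nrm x" for x
    using nrm_triangle[of "S x" "T x"] K(2)[of x] L(2)[of x] by (simp add: algebra_simps)
  then show ?thesis
    using S T by (intro bopsI) (auto simp: bops_add bops_scale scale_right_distrib)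
qed

lemma bops_scale_op: "T \<in> bops \<Longrightarrow> (\<lambda>x. c *s T x) \<in> bops"
proof -
  assume T: "T \<in> bops"
  then obtain K where K: "K > 0" "\<And>x. nrm (T x) \<le> K * nrm x" using bops_bound by blast
  have "nrm (c *s T x) \<le> (cmod c * K) * nrm x" for x
    using mult_left_mono[OF K(2)[of x], of "cmod c"] by (simp add: nrm_scale mult.assoc)
  then show ?thesis
    using T by (intro bopsI[where K = "cmod c * K"]) (auto simp: bops_add bops_scale scale_right_distrib mult.commute)
qed

lemma bops_minus_op: "T \<in> bops \<Longrightarrow> (\<lambda>x. - T x) \<in> bops"
  using bops_scale_op[of T "- 1"] by simp

lemma bops_diff_op: "S \<in> bops \<Longrightarrow> T \<in> bops \<Longrightarrow> (\<lambda>x. S x - T x) \<in> bops"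
  using bops_sum[OF _ bops_minus_op, of S T] by simp

lemma bops_id: "(\<lambda>x. x) \<in> bops"
  by (rule bopsI[where K = 1]) auto

lemma bops_rank_one: "(\<lambda>x. ip x y *s z) \<in> bops"
  by (rule bopsI[where K = "nrm y * nrm z"])
    (auto simp: ip_simps scale_left_distrib nrm_scale cauchy_schwarz
      mult.assoc[symmetric] mult.commute[of "nrm y * nrm z"] intro!: mult_right_mono)

end

subsection \<open>Hilbert spaces\<close>

locale hilbert_form = inner_form +
  assumes mcomplete: "metric.mcomplete"
begin

text \<open>Completeness in the shape needed for minimising sequences and for the square root
  iteration: the rate \<open>g n\<close> bounds the distance from the \<open>n\<close>-th term to
  all later ones.\<close>

lemma cauchy_converges:
  assumes X: "\<And>m n. n \<le> m \<Longrightarrow> nrm (X m - X n) \<le> g n" and g: "g \<longlonglongrightarrow> (0::real)"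
  obtains l where "converges X l"
proof -
  have "metric.MCauchy X"
    unfolding metric.MCauchy_def form_dist_eq_nrm
  proof (intro conjI allI impI)
    fix e :: real assume "e > 0"
    then obtain N where N: "\<And>n. n \<ge> N \<Longrightarrow> g n < e"
      using order_tendstoD(2)[OF g] by (auto simp: eventually_sequentially)
    have "nrm (X m - X n) < e" if "N \<le> m" "N \<le> n" for m n
      using X[of m n] X[of n m] N[of m] N[of n] nrm_minus_commute[of "X m" "X n"] that
      by (cases "m \<le> n") auto
    then show "\<exists>N. \<forall>n n'. N \<le> n \<longrightarrow> N \<le> n' \<longrightarrow> nrm (X n - X n') < e" by blast
  qed simp
  then show thesis
    using mcomplete that by (auto simp: metric.mcomplete_def limitin_iff_converges)
qed

section \<open>Orthogonal projections onto closed subspaces\<close>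

definition proj :: "'a set \<Rightarrow> 'a \<Rightarrow> 'a" where
  "proj S x = (THE p. p \<in> S \<and> (\<forall>s\<in>S. ip (x - p) s = 0))"

text \<open>A minimising sequence for the distance to \<open>S\<close> is Cauchy by the
  parallelogram law. Its limit lies in \<open>S\<close> by closedness, and the first variation at
  this nearest point gives orthogonality.\<close>

lemma ex_projection:
  assumes S: "subspace S" and cl: "closedin metric.mtopology S"
  shows "\<exists>p\<in>S. \<forall>s\<in>S. ip (x - p) s = 0"
proof -
  define d where "d = (INF s\<in>S. (nrm (x - s))\<^sup>2)"
  have ne: "S \<noteq> {}" using subspace_0[OF S] by auto
  have bdd: "bdd_below ((\<lambda>s. (nrm (x - s))\<^sup>2) ` S)"
    by (rule bdd_belowI2[where m = 0]) simp
  have d_le: "d \<le> (nrm (x - s))\<^sup>2" if "s \<in> S" for s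
    unfolding d_def using bdd that by (rule cINF_lower)
  have "\<exists>s\<in>S. (nrm (x - s))\<^sup>2 < d + 1 / Suc n" for n
    using cINF_less_iff[OF ne bdd, of "d + 1 / Suc n"] by (simp add: d_def)
  then obtain X where X: "\<And>n. X n \<in> S" "\<And>n. (nrm (x - X n))\<^sup>2 < d + 1 / Suc n"
    by metis
  \<comment> \<open>The midpoint of \<open>X m\<close> and \<open>X n\<close> is in
    \<open>S\<close>, so its distance to \<open>x\<close> bounds \<open>?u + ?v\<close> from below;
    the parallelogram law then leaves at most \<open>2 / Suc m + 2 / Suc n\<close> for the squared
    difference.\<close>
  have cauchy: "nrm (X m - X n) \<le> sqrt (4 / Suc n)" if "n \<le> m" for m n
  proof -
    let ?u = "x - X m" and ?v = "x - X n"
    have "(1/2) *s (X m + X n) \<in> S"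
      using S X by (intro subspace_scale subspace_add)
    then have "d \<le> (nrm (x - (1/2) *s (X m + X n)))\<^sup>2" by (rule d_le)
    moreover have "?u + ?v = 2 *s (x - (1/2) *s (X m + X n))"
      using scale_left_distrib[of 1 1 x]
      by (simp add: scale_right_diff_distrib scale_right_distrib algebra_simps)
    ultimately have "4 * d \<le> (nrm (?u + ?v))\<^sup>2"
      by (simp add: nrm_scale power_mult_distrib)
    moreover have "(nrm (?u + ?v))\<^sup>2 + (nrm (?u - ?v))\<^sup>2 = 2 * (nrm ?u)\<^sup>2 + 2 * (nrm ?v)\<^sup>2"
      unfolding nrm_add_square[of ?u] nrm_diff_square[of ?u] by simp
    moreover have "nrm (?u - ?v) = nrm (X m - X n)"
      using nrm_minus_commute[of "X m" "X n"] by simp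
    moreover have "1 / real (Suc m) \<le> 1 / real (Suc n)"
      using that by (simp add: frac_le)
    ultimately have "(nrm (X m - X n))\<^sup>2 \<le> 4 / Suc n"
      using X(2)[of m] X(2)[of n] by simp
    then show ?thesis by (rule real_le_rsqrt)
  qed
  have "(\<lambda>n. sqrt (4 / Suc n)) \<longlonglongrightarrow> sqrt 0"
    by (intro tendsto_real_sqrt LIMSEQ_Suc lim_const_over_n)
  then obtain p where p: "converges X p"
    using cauchy cauchy_converges[of X "\<lambda>n. sqrt (4 / Suc n)"] by auto
  then have pS: "p \<in> S" using closedinD[OF cl, of X p] X(1) by blast
  have "converges (\<lambda>n. x - X n) (x - p)"
    using p by (rule converges_bounded[where K = 1]) (simp add: nrm_minus_commute)
  then have "(\<lambda>n. (nrm (x - X n))\<^sup>2) \<longlonglongrightarrow> (nrm (x - p))\<^sup>2"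
    by (intro tendsto_power tendsto_nrm)
  moreover have "(\<lambda>n. d + 1 / Suc n) \<longlonglongrightarrow> d + 0"
    by (intro tendsto_add tendsto_const LIMSEQ_Suc lim_const_over_n)
  ultimately have le_d: "(nrm (x - p))\<^sup>2 \<le> d + 0"
    using X(2) by (intro LIMSEQ_le[where X = "\<lambda>n. (nrm (x - X n))\<^sup>2"]) (auto intro: less_imp_le)
  then have min: "(nrm (x - p))\<^sup>2 \<le> (nrm (x - s))\<^sup>2" if "s \<in> S" for s
    using d_le[OF that] le_d by linarith
  have "ip (x - p) s = 0" if "s \<in> S" for s
  proof (rule ip_zero_if_minimal)
    fix c
    have "p - c *s s \<in> S" using S pS that by (intro subspace_diff subspace_scale)
    from min[OF this] show "Re (ip (x - p) (x - p)) \<le> Re (ip (x - p + c *s s) (x - p + c *s s))"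
      unfolding Re_ip_self by (simp add: algebra_simps)
  qed
  with pS show ?thesis by blast
qed

context
  fixes S
  assumes S: "subspace S" and cl: "closedin metric.mtopology S"
begin

lemma ex1_projection: "\<exists>!p. p \<in> S \<and> (\<forall>s\<in>S. ip (x - p) s = 0)"
proof -
  have "p = q" if p: "p \<in> S" "\<forall>s\<in>S. ip (x - p) s = 0" and q: "q \<in> S" "\<forall>s\<in>S. ip (x - q) s = 0" for p q
  proof -
    have "q - p \<in> S" using S p q by (intro subspace_diff)
    then have "ip (x - p) (q - p) - ip (x - q) (q - p) = 0" using p q by simp
    then have "ip (q - p) (q - p) = 0" by (simp flip: ip_diff_left)
    then show ?thesis using ip_pos[of "q - p"] by auto
  qed
  then show ?thesis using ex_projection[OF S cl, of x] by blast
qed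

lemma proj_in: "proj S x \<in> S"
  and proj_orthogonal: "s \<in> S \<Longrightarrow> ip (x - proj S x) s = 0"
  using theI'[OF ex1_projection[of x]] unfolding proj_def by blast+

lemma proj_eqI: "p \<in> S \<Longrightarrow> (\<And>s. s \<in> S \<Longrightarrow> ip (x - p) s = 0) \<Longrightarrow> proj S x = p"
  using ex1_projection[of x] proj_in proj_orthogonal by blast

lemma proj_id: "x \<in> S \<Longrightarrow> proj S x = x"
  by (rule proj_eqI) auto

lemma nrm_proj_le: "nrm (proj S x) \<le> nrm x"
proof -
  have "(nrm x)\<^sup>2 = (nrm (x - proj S x))\<^sup>2 + (nrm (proj S x))\<^sup>2"
    using nrm_add_square[of "x - proj S x" "proj S x"] proj_orthogonal[OF proj_in[of x], of x] by simp
  then have "(nrm (proj S x))\<^sup>2 \<le> (nrm x)\<^sup>2" by simp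
  then show ?thesis by (rule power2_le_imp_le) simp
qed

lemma proj_bops: "proj S \<in> bops"
proof (rule bopsI[where K = 1])
  show "proj S (x + y) = proj S x + proj S y" for x y
  proof (rule proj_eqI)
    show "ip (x + y - (proj S x + proj S y)) s = 0" if "s \<in> S" for s
      using proj_orthogonal[OF that, of x] proj_orthogonal[OF that, of y]
      by (simp add: ip_simps)
  qed (use S in \<open>intro subspace_add proj_in\<close>)
  show "proj S (c *s x) = c *s proj S x" for c x
  proof (rule proj_eqI)
    show "ip (c *s x - c *s proj S x) s = 0" if "s \<in> S" for s
      using proj_orthogonal[OF that, of x] by (simp add: ip_simps)
  qed (use S in \<open>intro subspace_scale proj_in\<close>)
qed (simp add: nrm_proj_le)

lemma proj_selfadjoint: "ip (proj S x) y = ip x (proj S y)"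
proof -
  have "ip (x - proj S x) (proj S y) = 0" by (simp add: proj_orthogonal proj_in)
  moreover have "ip (proj S x) (y - proj S y) = 0"
    using proj_orthogonal[OF proj_in, of y x] ip_eq_0_commute by blast
  ultimately show ?thesis by (simp add: ip_simps)
qed

end

section \<open>Closed subspaces, Riesz representation and adjoints\<close>

lemma subspace_orth_companion: "subspace (orth_companion S)"
  by (auto simp: orth_companion_def subspace_def ip_simps)

lemma closedin_orth_companion: "closedin metric.mtopology (orth_companion S)"
  unfolding closedin_iff_sequential orth_companion_def mem_Collect_eq
proof (intro allI impI ballI)
  fix X l s
  assume X: "\<forall>n. \<forall>s\<in>S. ip (X n) s = 0" "converges X l" and s: "s \<in> S"
  from X(2) have "(\<lambda>n. ip (X n) s) \<longlonglongrightarrow> ip l s" by (rule tendsto_ip_left)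
  then show "ip l s = 0" using X(1) s by (simp add: LIMSEQ_const_iff)
qed

lemma bops_kernel:
  assumes T: "T \<in> bops"
  shows "subspace {x. T x = 0}" "closedin metric.mtopology {x. T x = 0}"
proof -
  show "subspace {x. T x = 0}"
    using T by (simp add: subspace_def bops_add bops_scale)
  show "closedin metric.mtopology {x. T x = 0}"
    unfolding closedin_iff_sequential mem_Collect_eq
  proof (intro allI impI)
    fix X l assume X: "\<forall>n. T (X n) = 0" "converges X l"
    from T X(2) have "converges (\<lambda>n. T (X n)) (T l)" by (rule bops_converges)
    then show "T l = 0" using X(1) converges_unique[OF converges_const, of 0 "T l"] by simp
  qed
qed

text \<open>A nonzero bounded functional is determined up to a factor by its closed kernel; a vector
  \<open>u\<close> orthogonal to the kernel represents it after rescaling.\<close>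

lemma riesz:
  fixes \<phi> :: "'a \<Rightarrow> complex"
  assumes add: "\<And>x y. \<phi> (x + y) = \<phi> x + \<phi> y" and scale: "\<And>c x. \<phi> (c *s x) = c * \<phi> x"
    and bound: "\<And>x. cmod (\<phi> x) \<le> K * nrm x"
  shows "\<exists>w. \<forall>x. \<phi> x = ip x w"
proof (cases "\<exists>v. \<phi> v \<noteq> 0")
  case True
  then obtain v where v: "\<phi> v \<noteq> 0" by blast
  let ?N = "{x. \<phi> x = 0}"
  have diff: "\<phi> (x - y) = \<phi> x - \<phi> y" for x y
    using add[of "x - y" y] by simp
  have N: "subspace ?N"
    using scale[of 0 0] by (auto simp: subspace_def add scale)
  have cl: "closedin metric.mtopology ?N"
    unfolding closedin_iff_sequential
  proof (intro allI impI)
    fix X l assume X: "\<forall>n. X n \<in> ?N" "converges X l"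
    have "cmod (\<phi> l) \<le> K * nrm (X n - l)" for n
      using bound[of "X n - l"] X(1) by (simp add: diff)
    moreover have "(\<lambda>n. K * nrm (X n - l)) \<longlonglongrightarrow> K * 0"
      using X(2) unfolding converges_def by (intro tendsto_mult tendsto_const)
    ultimately have "cmod (\<phi> l) \<le> K * 0"
      by (intro LIMSEQ_le_const[where X = "\<lambda>n. K * nrm (X n - l)"]) auto
    then show "l \<in> ?N" by simp
  qed
  define u where "u = v - proj ?N v"
  have \<phi>u: "\<phi> u = \<phi> v"
    using proj_in[OF N cl, of v] by (simp add: u_def diff)
  have u: "ip u s = 0" if "\<phi> s = 0" for s
    using proj_orthogonal[OF N cl, of s v] that by (simp add: u_def)
  have "u \<noteq> 0" using v scale[of 0 0] by (auto simp flip: \<phi>u)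
  then have uu: "ip u u \<noteq> 0" using ip_pos[of u] by auto
  have "\<phi> x = ip x (cnj (\<phi> v / ip u u) *s u)" for x
  proof -
    \<comment> \<open>Every \<open>x\<close> differs from a multiple of \<open>u\<close> by an
      element of the kernel.\<close>
    have "\<phi> (x - (\<phi> x / \<phi> u) *s u) = 0" using v by (simp add: diff scale \<phi>u)
    from u[OF this] have "ip (x - (\<phi> x / \<phi> u) *s u) u = 0"
      using ip_eq_0_commute by blast
    then show ?thesis using v uu by (simp add: ip_simps \<phi>u field_simps)
  qed
  then show ?thesis by blast
qed (auto intro!: exI[of _ 0])

lemma ex_adjoint:
  assumes T: "T \<in> bops"
  shows "\<exists>S\<in>bops. \<forall>x y. ip (T x) y = ip x (S y)"
proof -
  obtain K where K: "K > 0" "\<And>x. nrm (T x) \<le> K * nrm x" using bops_bound[OF T] by blast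
  have "\<exists>w. \<forall>x. ip (T x) y = ip x w" for y
  proof (rule riesz)
    show "cmod (ip (T x) y) \<le> (K * nrm y) * nrm x" for x
      using cauchy_schwarz[of "T x" y] mult_right_mono[OF K(2)[of x], of "nrm y"]
      by (simp add: mult_ac)
  qed (use T in \<open>simp_all add: bops_add bops_scale ip_simps\<close>)
  then obtain S where S: "\<And>x y. ip (T x) y = ip x (S y)" by metis
  have eqI: "u = v" if "\<And>x. ip x u = ip x v" for u v
    using that by (intro ip_eq_imp_eq) (metis ip_hermitian)
  have "S \<in> bops"
  proof (rule bopsI[where K = K])
    show "S (x + y) = S x + S y" for x y
      by (rule eqI) (simp add: ip_add_right flip: S)
    show "S (c *s x) = c *s S x" for c x
      by (rule eqI) (simp add: ip_scale_right flip: S)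
    \<comment> \<open>Testing the adjoint relation at \<open>x = S y\<close> and dividing by
      \<open>nrm (S y)\<close> transfers the bound \<open>K\<close> from \<open>T\<close> to
      \<open>S\<close>.\<close>
    show "nrm (S y) \<le> K * nrm y" for y
    proof (cases "S y = 0")
      case False
      have "(nrm (S y))\<^sup>2 = cmod (ip (T (S y)) y)"
        by (simp add: S ip_self flip: of_real_power)
      also have "\<dots> \<le> nrm (T (S y)) * nrm y" by (rule cauchy_schwarz)
      also have "\<dots> \<le> K * nrm (S y) * nrm y" by (intro mult_right_mono K) simp
      finally have "nrm (S y) * nrm (S y) \<le> nrm (S y) * (K * nrm y)"
        by (simp add: power2_eq_square mult_ac)
      moreover have "0 < nrm (S y)" using False by (simp add: order_less_le)
      ultimately show ?thesis by simp
    qed (use K in simp)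
  qed
  with S show ?thesis by blast
qed

text \<open>The description by sequences lets inner product estimates on \<open>S\<close> pass to
  its closure; in the factorization below, \<open>S\<close> is the range of an adjoint.\<close>

lemma closure_subspace:
  assumes S: "subspace S"
  defines "V \<equiv> metric.mtopology closure_of S"
  shows "subspace V" "closedin metric.mtopology V" "S \<subseteq> V"
    "\<And>v. v \<in> V \<Longrightarrow> \<exists>X. (\<forall>n. X n \<in> S) \<and> converges X v"
proof -
  show seq: "\<exists>X. (\<forall>n. X n \<in> S) \<and> converges X v" if "v \<in> V" for v
  proof -
    have "\<exists>y\<in>S. nrm (y - v) < 1 / Suc n" for n
      using that unfolding V_def metric.metric_closure_of
      by (auto simp: form_dist_eq_nrm nrm_minus_commute dest!: spec[of _ "1 / real (Suc n)"])
    then obtain X where X: "\<And>n. X n \<in> S" "\<And>n. nrm (X n - v) < 1 / Suc n" by metis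
    have "(\<lambda>n. 1 / real (Suc n)) \<longlonglongrightarrow> 0" by (intro LIMSEQ_Suc lim_const_over_n)
    then have "converges X v" unfolding converges_def
      by (rule tendsto_sandwich[OF _ _ tendsto_const, rotated 2]) (auto intro!: always_eventually less_imp_le X simp del: of_nat_Suc)
    with X(1) show ?thesis by blast
  qed
  show cl: "closedin metric.mtopology V" by (simp add: V_def)
  show sub: "S \<subseteq> V" unfolding V_def by (rule closure_of_subset) simp
  show "subspace V"
    unfolding subspace_def
  proof (intro conjI ballI allI)
    show "0 \<in> V" using sub subspace_0[OF S] by blast
    fix x assume "x \<in> V"
    then obtain X where X: "\<And>n. X n \<in> S" "converges X x" using seq by blast
    show "c *s x \<in> V" for c
      using subspace_scale[OF S X(1)] sub by (intro closedinD[OF cl _ converges_scale[OF X(2)]]) blast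
    fix y assume "y \<in> V"
    then obtain Y where Y: "\<And>n. Y n \<in> S" "converges Y y" using seq by blast
    show "x + y \<in> V"
      using subspace_add[OF S X(1) Y(1)] sub
      by (intro closedinD[OF cl _ converges_add[OF X(2) Y(2)]]) blast
  qed
qed

end

subsection \<open>Square roots and the sign decomposition\<close>

text \<open>This is the iteration \<open>sqrt_iter\<close> below for the scalar \<open>A = 1\<close>; it dominates the operator one in
  norm, so no power series or positivity argument is needed for convergence.\<close>

fun sqrt_bound :: "nat \<Rightarrow> real" where
  "sqrt_bound 0 = 0"
| "sqrt_bound (Suc n) = (1 + (sqrt_bound n)\<^sup>2) / 2"

lemma sqrt_bound_range: "0 \<le> sqrt_bound n \<and> sqrt_bound n \<le> 1"
  by (induction n) (auto simp: power_le_one)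

text \<open>The increment is half the square of \<open>1 - sqrt_bound n\<close>.\<close>

lemma incseq_sqrt_bound: "incseq sqrt_bound"
  using zero_le_power2[of "1 - sqrt_bound _"]
  by (auto intro!: incseq_SucI simp: power2_eq_square field_simps)

context hilbert_form
begin

definition selfadjoint :: "('a \<Rightarrow> 'a) \<Rightarrow> bool" where
  "selfadjoint T \<longleftrightarrow> (\<forall>x y. ip (T x) y = ip x (T y))"

lemma selfadjointD: "selfadjoint T \<Longrightarrow> ip (T x) y = ip x (T y)"
  by (simp add: selfadjoint_def)

text \<open>If \<open>Y\<close> solves \<open>Y = (A + Y\<^sup>2) / 2\<close> then \<open>1 - Y\<close> is a square root of \<open>1 - A\<close>.\<close>

primrec sqrt_iter :: "('a \<Rightarrow> 'a) \<Rightarrow> nat \<Rightarrow> 'a \<Rightarrow> 'a" where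
  "sqrt_iter A 0 = (\<lambda>x. 0)"
| "sqrt_iter A (Suc n) = (\<lambda>x. (1/2) *s (A x + sqrt_iter A n (sqrt_iter A n x)))"

text \<open>The iterates are polynomials in \<open>A\<close>, so each of them is selfadjoint and
  commutes with every operator commuting with \<open>A\<close>; both properties pass to the
  pointwise limit. The limit exists because the increments are dominated by those of
  \<open>sqrt_bound\<close>.\<close>

lemma sqrt_fixed_point:
  assumes A: "A \<in> bops" "\<And>x. nrm (A x) \<le> nrm x" "selfadjoint A"
  obtains Y where "Y \<in> bops" "\<And>x. nrm (Y x) \<le> nrm x" "selfadjoint Y"
    "\<And>x. Y x = (1/2) *s (A x + Y (Y x))"
    "\<And>T x. T \<in> bops \<Longrightarrow> (\<And>x. T (A x) = A (T x)) \<Longrightarrow> T (Y x) = Y (T x)"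
proof -
  let ?Y = "sqrt_iter A" and ?r = sqrt_bound
  have Yb: "?Y n \<in> bops" for n
  proof (induction n)
    case 0
    show ?case by (rule bopsI[where K = 0]) auto
  next
    case (Suc n)
    show ?case
      using bops_scale_op[OF bops_sum[OF A(1) bops_compose[OF Suc Suc]], of "1/2"] by simp
  qed
  have Yn: "nrm (?Y n x) \<le> ?r n * nrm x" for n x
  proof (induction n arbitrary: x)
    case (Suc n)
    have "nrm (?Y n (?Y n x)) \<le> ?r n * (?r n * nrm x)"
      using sqrt_bound_range[of n] by (intro order_trans[OF Suc.IH] mult_left_mono Suc.IH) auto
    then have "nrm (A x + ?Y n (?Y n x)) \<le> nrm x + ?r n * (?r n * nrm x)"
      using nrm_triangle[of "A x" "?Y n (?Y n x)"] A(2)[of x] by linarith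
    then show ?case
      by (simp only: sqrt_iter.simps nrm_scale) (simp add: power2_eq_square algebra_simps)
  qed simp
  have Ys: "selfadjoint (?Y n)" for n
    by (induction n) (use A(3) in \<open>auto simp: selfadjoint_def ip_simps\<close>)
  have Yc: "T (?Y n x) = ?Y n (T x)" if "T \<in> bops" "\<And>x. T (A x) = A (T x)" for T n x
    by (induction n arbitrary: x) (use that in \<open>auto simp: bops_scale bops_add\<close>)
  \<comment> \<open>Induction through \<open>U U - V V = U (U - V) + (U - V) V\<close>; the norm
    bounds of the factors reproduce the scalar increment \<open>(u * u - v * v) / 2\<close>.\<close>
  have step: "nrm (?Y (Suc n) x - ?Y n x) \<le> (?r (Suc n) - ?r n) * nrm x" for n x
  proof (induction n arbitrary: x)
    case 0
    show ?case using A(2)[of x] by (simp add: nrm_scale)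
  next
    case (Suc n)
    define U V where "U = ?Y (Suc n)" and "V = ?Y n"
    define u v where "u = ?r (Suc n)" and "v = ?r n"
    have uv: "0 \<le> u" "0 \<le> v" "v \<le> u"
      using sqrt_bound_range[of n] sqrt_bound_range[of "Suc n"] incseq_SucD[OF incseq_sqrt_bound, of n]
      unfolding u_def v_def by auto
    have IH: "nrm (U x - V x) \<le> (u - v) * nrm x" for x
      using Suc.IH[of x] unfolding U_def V_def u_def v_def .
    have "nrm (U (U x - V x)) \<le> u * ((u - v) * nrm x)"
      using Yn[of "Suc n" "U x - V x"] mult_left_mono[OF IH[of x] uv(1)]
      unfolding U_def u_def by linarith
    moreover have "nrm (U (V x) - V (V x)) \<le> (u - v) * (v * nrm x)"
      using IH[of "V x"] mult_left_mono[OF Yn[of n x], of "u - v"] uv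
      unfolding V_def v_def by linarith
    moreover have "U (U x - V x) + (U (V x) - V (V x)) = U (U x) - V (V x)"
      using bops_diff[OF Yb[of "Suc n"]] by (simp add: U_def)
    ultimately have "nrm (U (U x) - V (V x)) \<le> u * ((u - v) * nrm x) + (u - v) * (v * nrm x)"
      using nrm_triangle[of "U (U x - V x)" "U (V x) - V (V x)"] by (simp only:)
    moreover have "?Y (Suc (Suc n)) x - ?Y (Suc n) x = (1/2) *s (U (U x) - V (V x))"
      by (simp add: U_def V_def flip: scale_right_diff_distrib)
    moreover have "?r (Suc (Suc n)) - ?r (Suc n) = (u * u - v * v) / 2"
      by (simp add: u_def v_def power2_eq_square field_simps)
    ultimately show ?case by (simp only: nrm_scale) (simp add: algebra_simps)
  qed
  obtain L where L: "?r \<longlonglongrightarrow> L" "\<And>n. ?r n \<le> L"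
    using incseq_convergent[OF incseq_sqrt_bound, of 1] sqrt_bound_range by auto
  have "nrm (?Y m x - ?Y n x) \<le> (?r m - ?r n) * nrm x" if "n \<le> m" for m n x
    using that
  proof (induction m rule: dec_induct)
    case (step m)
    then show ?case
      using nrm_triangle_diff[of "?Y (Suc m) x" "?Y n x" "?Y m x"] \<open>\<And>x n. nrm (?Y (Suc n) x - ?Y n x) \<le> _\<close>[of m x]
      by (simp only: left_diff_distrib)
  qed simp
  \<comment> \<open>Replacing \<open>?r m\<close> by the limit \<open>L\<close> gives a rate that no
    longer depends on \<open>m\<close>.\<close>
  then have cauchy: "nrm (?Y m x - ?Y n x) \<le> (L - ?r n) * nrm x" if "n \<le> m" for m n x
    by (rule order_trans[OF _ mult_right_mono]) (use that L(2) in auto)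
  have g: "(\<lambda>n. (L - ?r n) * nrm x) \<longlonglongrightarrow> 0" for x
    using L(1) by (auto intro!: tendsto_eq_intros)
  have "\<exists>l. converges (\<lambda>n. ?Y n x) l" for x
    using cauchy_converges[OF cauchy g] by blast
  then obtain Y where Y: "\<And>x. converges (\<lambda>n. ?Y n x) (Y x)" by metis
  have Yn1: "nrm (?Y n x) \<le> nrm x" for n x
    using Yn[of n x] mult_right_mono[of "?r n" 1 "nrm x"] sqrt_bound_range[of n] by simp
  have Y1: "nrm (Y x) \<le> nrm x" for x
    by (rule LIMSEQ_le_const2[OF tendsto_nrm[OF Y]]) (use Yn1 in blast)
  have YB: "Y \<in> bops"
  proof (rule bopsI[where K = 1])
    show "Y (x + y) = Y x + Y y" for x y
      using converges_add[OF Y[of x] Y[of y]] Y[of "x + y"] converges_unique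
      by (simp flip: bops_add[OF Yb])
    show "Y (c *s x) = c *s Y x" for c x
      using converges_scale[OF Y[of x], of c] Y[of "c *s x"] converges_unique
      by (simp flip: bops_scale[OF Yb])
  qed (simp add: Y1)
  have "selfadjoint Y"
    unfolding selfadjoint_def
  proof (intro allI)
    fix x y
    have "(\<lambda>n. ip (?Y n x) y) \<longlonglongrightarrow> ip x (Y y)"
      using tendsto_ip_right[OF Y[of y]] by (simp add: selfadjointD[OF Ys])
    then show "ip (Y x) y = ip x (Y y)"
      using tendsto_ip_left[OF Y[of x]] LIMSEQ_unique by blast
  qed
  moreover have "Y x = (1/2) *s (A x + Y (Y x))" for x
  proof -
    \<comment> \<open>The iterates are uniformly contractive, so \<open>?Y n (?Y n x)\<close> and
      \<open>?Y n (Y x)\<close> have the same limit, and the recursion passes to the limit.\<close>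
    have "nrm (?Y n (?Y n x) - ?Y n (Y x)) \<le> 1 * nrm (?Y n x - Y x)" for n
      using Yn1[of n "?Y n x - Y x"] by (simp add: bops_diff[OF Yb])
    moreover have "converges (\<lambda>n. ?Y n (?Y n x) - ?Y n (Y x) + ?Y n (Y x)) (0 + Y (Y x))"
      using calculation by (intro converges_add Y converges_bounded[OF Y[of x], where K = 1]) simp
    ultimately have "converges (\<lambda>n. ?Y n (?Y n x)) (Y (Y x))" by simp
    then have "converges (\<lambda>n. ?Y (Suc n) x) ((1/2) *s (A x + Y (Y x)))"
      by (simp add: converges_scale converges_add converges_const)
    moreover have "converges (\<lambda>n. ?Y (Suc n) x) (Y x)"
      using Y[of x] LIMSEQ_Suc unfolding converges_def by blast
    ultimately show ?thesis by (rule converges_unique[rotated])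
  qed
  moreover have "T (Y x) = Y (T x)" if T: "T \<in> bops" "\<And>x. T (A x) = A (T x)" for T x
    using bops_converges[OF T(1) Y[of x]] Y[of "T x"] converges_unique
    by (simp add: Yc[OF T])
  ultimately show thesis using that YB Y1 by blast
qed

text \<open>With \<open>P\<close> the projection onto \<open>S\<close>, \<open>G = P J P\<close> and \<open>W = sqrt (G\<^sup>2)\<close>, the negative part is
  \<open>S \<inter> ker (W + G)\<close>; since \<open>(W + G) (W - G) = 0\<close>, \<open>G = W\<close> on its complement in \<open>S\<close>.\<close>

lemma ex_sign_decomposition:
  assumes S: "subspace S" and cl: "closedin metric.mtopology S"
    and J: "J \<in> bops" "\<And>x. nrm (J x) \<le> nrm x" "selfadjoint J"
  obtains Sp Sm where "subspace Sp" "closedin metric.mtopology Sp"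
    "subspace Sm" "closedin metric.mtopology Sm" "direct_sum S Sp Sm"
    "\<And>x y. x \<in> Sp \<Longrightarrow> y \<in> Sm \<Longrightarrow> ip x y = 0" "\<And>x y. x \<in> Sp \<Longrightarrow> y \<in> Sm \<Longrightarrow> ip (J x) y = 0"
    "\<And>x. x \<in> Sp \<Longrightarrow> x \<noteq> 0 \<Longrightarrow> 0 < Re (ip (J x) x)" "\<And>x. x \<in> Sm \<Longrightarrow> Re (ip (J x) x) \<le> 0"
proof -
  let ?P = "proj S"
  note P = proj_bops[OF S cl]
  have Psa: "ip (?P x) y = ip x (?P y)" for x y by (rule proj_selfadjoint[OF S cl])
  have PP: "?P x = x" if "x \<in> S" for x using that by (rule proj_id[OF S cl])
  have Pin: "?P x \<in> S" for x by (rule proj_in[OF S cl])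
  have P1: "nrm (?P x) \<le> nrm x" for x by (rule nrm_proj_le[OF S cl])
  define G where "G = (\<lambda>x. ?P (J (?P x)))"
  have G: "G \<in> bops" unfolding G_def by (rule bops_compose[OF P bops_compose[OF J(1) P]])
  have Gsa: "ip (G x) y = ip x (G y)" for x y
    by (simp add: G_def Psa selfadjointD[OF J(3)])
  have G1: "nrm (G x) \<le> nrm x" for x
    unfolding G_def by (meson P1 J(2) order_trans)
  have PG: "?P (G x) = G x" "G (?P x) = G x" for x by (simp_all add: G_def PP Pin)
  \<comment> \<open>On \<open>S\<close> the compression \<open>G\<close> gives the same form as
    \<open>J\<close>, so signs can be read off from \<open>G\<close>.\<close>
  have GJ: "ip (G x) y = ip (J x) y" if "x \<in> S" "y \<in> S" for x y
    using that by (simp add: G_def PP Psa)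
  \<comment> \<open>Chosen so that \<open>1 - A\<close> is the square of \<open>G\<close>; the fixed
    point \<open>Y\<close> then provides the root \<open>W = 1 - Y\<close>.\<close>
  define A where "A = (\<lambda>x. x - G (G x))"
  have A: "A \<in> bops" unfolding A_def by (rule bops_diff_op[OF bops_id bops_compose[OF G G]])
  \<comment> \<open>Expanding the square gives \<open>- 2\<close> times the square of
    \<open>nrm (G x)\<close>, which absorbs that of \<open>nrm (G (G x))\<close> because
    \<open>G\<close> is a contraction.\<close>
  have A1: "nrm (A x) \<le> nrm x" for x
  proof -
    have "Re (ip x (G (G x))) = (nrm (G x))\<^sup>2" using Re_ip_self[of "G x"] by (simp add: Gsa)
    then have "(nrm (A x))\<^sup>2 = (nrm x)\<^sup>2 - 2 * (nrm (G x))\<^sup>2 + (nrm (G (G x)))\<^sup>2"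
      by (simp add: A_def nrm_diff_square)
    also have "\<dots> \<le> (nrm x)\<^sup>2"
    proof -
      have "(nrm (G (G x)))\<^sup>2 \<le> (nrm (G x))\<^sup>2" by (intro power_mono G1) simp
      then show ?thesis using zero_le_power2[of "nrm (G x)"] by linarith
    qed
    finally show ?thesis by (rule power2_le_imp_le) simp
  qed
  have Asa: "selfadjoint A" by (simp add: selfadjoint_def A_def ip_simps Gsa)
  obtain Y where Y: "Y \<in> bops" "\<And>x. nrm (Y x) \<le> nrm x" "selfadjoint Y"
    "\<And>x. Y x = (1/2) *s (A x + Y (Y x))"
    "\<And>T x. T \<in> bops \<Longrightarrow> (\<And>x. T (A x) = A (T x)) \<Longrightarrow> T (Y x) = Y (T x)"
    using sqrt_fixed_point[OF A A1 Asa] by blast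
  define W where "W = (\<lambda>x. x - Y x)"
  have W: "W \<in> bops" unfolding W_def by (rule bops_diff_op[OF bops_id Y(1)])
  have Wsa: "ip (W x) y = ip x (W y)" for x y
    by (simp add: W_def ip_simps selfadjointD[OF Y(3)])
  have W2: "W (W x) = G (G x)" for x
  proof -
    have "2 *s Y x = A x + Y (Y x)" by (subst Y(4)) simp
    moreover have "2 *s Y x = Y x + Y x" using scale_left_distrib[of 1 1 "Y x"] by simp
    ultimately have "Y x + Y x = A x + Y (Y x)" by simp
    then show ?thesis by (simp add: W_def A_def bops_diff[OF Y(1)] algebra_simps)
  qed
  have WG: "G (W x) = W (G x)" for x
    using Y(5)[OF G, of x] by (simp add: W_def A_def bops_diff[OF G])
  have WP: "?P (W x) = W (?P x)" for x
    using Y(5)[OF P, of x] by (simp add: W_def A_def bops_diff[OF P] PG)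
  \<comment> \<open>The contraction bound on \<open>Y\<close> makes \<open>1 - Y\<close> positive
    semidefinite.\<close>
  have Wpos: "0 \<le> Re (ip (W x) x)" for x
  proof -
    have "Re (ip (Y x) x) \<le> nrm x * nrm x"
      using complex_Re_le_cmod[of "ip (Y x) x"] cauchy_schwarz[of "Y x" x]
        mult_right_mono[OF Y(2)[of x], of "nrm x"] by simp
    then show ?thesis by (simp add: W_def ip_simps Re_ip_self power2_eq_square)
  qed
  \<comment> \<open>For a positive semidefinite form a null vector is a minimum, so its first
    variation vanishes in every direction \<open>v\<close>.\<close>
  have Wker: "W x = 0" if "Re (ip (W x) x) = 0" for x
  proof -
    have "ip (W x) v = 0" for v
    proof (rule quadratic_nonneg_imp_zero)
      fix c
      have "0 \<le> Re (ip (W (x + c *s v)) (x + c *s v))" by (rule Wpos)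
      also have "\<dots> = 2 * Re (cnj c * ip (W x) v) + (cmod c)\<^sup>2 * Re (ip (W v) v)"
      proof -
        have "ip (W (x + c *s v)) (x + c *s v) =
            ip (W x) x + cnj c * ip (W x) v + c * ip (W v) x + (c * cnj c) * ip (W v) v"
          by (simp add: bops_add[OF W] bops_scale[OF W] ip_simps algebra_simps)
        moreover have "c * ip (W v) x = cnj (cnj c * ip (W x) v)"
          by (simp add: Wsa flip: ip_hermitian)
        moreover have "Re ((c * cnj c) * z) = (cmod c)\<^sup>2 * Re z" for z
          by (simp flip: complex_norm_square of_real_power)
        ultimately show ?thesis using that by simp
      qed
      finally show "0 \<le> 2 * Re (cnj c * ip (W x) v) + (cmod c)\<^sup>2 * Re (ip (W v) v)" .
    qed
    then show ?thesis using ip_eq_imp_eq[of "W x" 0] by simp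
  qed
  define Sm where "Sm = S \<inter> {x. W x + G x = 0}"
  define Sp where "Sp = S \<inter> orth_companion Sm"
  have WGb: "(\<lambda>x. W x + G x) \<in> bops" by (rule bops_sum[OF W G])
  have Sm: "subspace Sm" "closedin metric.mtopology Sm"
    unfolding Sm_def using S cl bops_kernel[OF WGb] by (auto intro: subspace_inter)
  have Sp: "subspace Sp" "closedin metric.mtopology Sp"
    unfolding Sp_def using S cl subspace_orth_companion closedin_orth_companion
    by (auto intro: subspace_inter)
  have orth: "ip x y = 0" if "x \<in> Sp" "y \<in> Sm" for x y
    using that by (auto simp: Sp_def orth_companion_def)
  have int: "Sp \<inter> Sm = {0}"
    using orth ip_pos Sp Sm subspace_0 by fastforce
  have "S \<subseteq> Sp + Sm"
  proof
    fix x assume x: "x \<in> S"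
    have "proj Sm x \<in> Sm" by (rule proj_in[OF Sm])
    moreover have "x - proj Sm x \<in> Sp"
      using x calculation S proj_orthogonal[OF Sm]
      by (auto simp: Sp_def orth_companion_def Sm_def intro: subspace_diff)
    ultimately have "x - proj Sm x + proj Sm x \<in> Sp + Sm" by (rule set_plus_intro[rotated])
    then show "x \<in> Sp + Sm" by simp
  qed
  moreover have "Sp + Sm \<subseteq> S"
    using S by (auto simp: Sp_def Sm_def elim!: set_plus_elim intro: subspace_add)
  ultimately have sum: "direct_sum S Sp Sm" using int by (auto simp: direct_sum_def)
  have Gm: "G y = - W y" if "y \<in> Sm" for y
    using that by (simp add: Sm_def eq_neg_iff_add_eq_0 add.commute)
  have WSm: "W y \<in> Sm" if "y \<in> Sm" for y
  proof -
    have "?P (W y) = W y" using that by (simp add: WP PP Sm_def)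
    then have "W y \<in> S" using Pin[of "W y"] by simp
    moreover have "W (W y) + G (W y) = W (W y + G y)"
      by (simp add: WG bops_add[OF W])
    ultimately show ?thesis using that W by (simp add: Sm_def)
  qed
  \<comment> \<open>The defect \<open>d\<close> lies in \<open>Sm\<close> as
    \<open>(W + G) (W - G) = 0\<close>. Moving \<open>W - G\<close> across the inner product pairs
    \<open>x\<close> with an element of \<open>Sm\<close>, so \<open>d\<close> vanishes.\<close>
  have GW: "G x = W x" if x: "x \<in> Sp" for x
  proof -
    define d where "d = W x - G x"
    have xS: "x \<in> S" using x by (simp add: Sp_def)
    have "?P d = d" using xS by (simp add: d_def bops_diff[OF P] WP PP PG)
    then have "d \<in> S" using Pin[of d] by simp
    moreover have "W d + G d = 0" by (simp add: d_def bops_diff[OF W] bops_diff[OF G] W2 WG)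
    ultimately have dm: "d \<in> Sm" by (simp add: Sm_def)
    have "ip d d = ip x (W d - G d)" unfolding d_def[symmetric]
      by (subst d_def) (simp add: ip_simps Wsa Gsa)
    also have "\<dots> = 0"
    proof (rule orth[OF x])
      show "W d - G d \<in> Sm"
        using WSm[OF dm] Sm(1) by (simp add: Gm[OF dm] subspace_add)
    qed
    finally show ?thesis using ip_pos[of d] by (force simp: d_def)
  qed
  have "ip (J x) y = 0" if "x \<in> Sp" "y \<in> Sm" for x y
  proof -
    have "ip (J x) y = ip (G x) y" using that by (intro GJ[symmetric]) (auto simp: Sp_def Sm_def)
    also have "\<dots> = ip x (W y)" by (simp add: GW that Wsa)
    also have "\<dots> = 0" using that WSm by (intro orth)
    finally show ?thesis .
  qed
  moreover have "0 < Re (ip (J x) x)" if x: "x \<in> Sp" "x \<noteq> 0" for x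
  proof -
    have xS: "x \<in> S" using x by (simp add: Sp_def)
    \<comment> \<open>A zero value would give \<open>W x = 0\<close> and \<open>G x = 0\<close>,
      hence \<open>x\<close> in \<open>Sm\<close>: the kernel is assigned to \<open>Sm\<close>,
      which makes \<open>Sp\<close> strictly positive.\<close>
    have "Re (ip (W x) x) \<noteq> 0"
    proof
      assume "Re (ip (W x) x) = 0"
      then have "W x = 0" by (rule Wker)
      then have "x \<in> Sm" using GW[OF x(1)] xS by (simp add: Sm_def)
      then show False using x int by blast
    qed
    then show ?thesis using Wpos[of x] GJ[OF xS xS] GW[OF x(1)] by simp
  qed
  moreover have "Re (ip (J x) x) \<le> 0" if x: "x \<in> Sm" for x
  proof -
    have "ip (J x) x = - ip (W x) x"
      using GJ[of x x] Gm[OF x] x by (simp add: Sm_def)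
    then show ?thesis using Wpos[of x] by simp
  qed
  ultimately show thesis using that[OF Sp Sm sum orth] by blast
qed

text \<open>The sets \<open>F k\<close> below cover the space because \<open>range M \<subseteq> range N\<close>,
  so by Baire one of them contains a ball.\<close>

lemma douglas:
  assumes M: "M \<in> bops" and N: "N \<in> bops" and range: "range M \<subseteq> range N"
  shows "\<exists>Z\<in>bops. \<forall>x. N (Z x) = M x"
proof -
  obtain Na where Na: "Na \<in> bops" "\<And>x y. ip (N x) y = ip x (Na y)"
    using ex_adjoint[OF N] by blast
  define F where "F = (\<lambda>k::nat. {x. \<forall>y. cmod (ip (M x) y) \<le> real k * nrm (Na y)})"
  have F_closed: "closedin metric.mtopology (F k)" for k
    unfolding closedin_iff_sequential F_def mem_Collect_eq
  proof (intro allI impI)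
    fix X l y assume X: "\<forall>n y. cmod (ip (M (X n)) y) \<le> real k * nrm (Na y)" "converges X l"
    have "(\<lambda>n. cmod (ip (M (X n)) y)) \<longlonglongrightarrow> cmod (ip (M l) y)"
      by (intro tendsto_norm tendsto_ip_left bops_converges[OF M] X)
    then show "cmod (ip (M l) y) \<le> real k * nrm (Na y)"
      by (rule LIMSEQ_le_const2) (use X in auto)
  qed
  have "x \<in> \<Union> (range F)" for x
  proof -
    obtain z where z: "M x = N z" using range by auto
    obtain k :: nat where k: "nrm z \<le> k" using real_arch_simple by blast
    have "cmod (ip (M x) y) \<le> real k * nrm (Na y)" for y
      using cauchy_schwarz[of z "Na y"] mult_right_mono[OF k, of "nrm (Na y)"]
      by (simp add: z Na(2))
    then show ?thesis by (auto simp: F_def)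
  qed
  then have "\<Union> (range F) = UNIV" by blast
  then have "metric.mtopology interior_of \<Union> (range F) \<noteq> {}"
    using interior_of_topspace[of metric.mtopology] by simp
  then obtain k where "metric.mtopology interior_of F k \<noteq> {}"
    using metric.metric_Baire_category_alt[OF mcomplete, of "range F"] F_closed
    by (auto simp: image_iff)
  then obtain x0 e where e: "e > 0" and ball: "metric.mball x0 e \<subseteq> F k"
    by (auto simp: metric.metric_interior_of)
  \<comment> \<open>Small vectors are differences of two points of the ball, which doubles the
    constant \<open>k\<close>.\<close>
  have near: "cmod (ip (M x) y) \<le> 2 * k * nrm (Na y)" if "nrm x < e" for x y
  proof -
    have "x0 + x \<in> F k" "x0 \<in> F k"
      using ball e that by (auto simp: subset_iff form_dist_eq_nrm)
    then have "cmod (ip (M (x0 + x)) y) \<le> k * nrm (Na y)" "cmod (ip (M x0) y) \<le> k * nrm (Na y)"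
      by (simp_all add: F_def)
    moreover have "ip (M x) y = ip (M (x0 + x)) y - ip (M x0) y"
      by (simp add: bops_add[OF M] ip_simps)
    ultimately show ?thesis
      using norm_triangle_ineq4[of "ip (M (x0 + x)) y" "ip (M x0) y"] by simp
  qed
  \<comment> \<open>Rescaling \<open>x\<close> to norm \<open>e / 2\<close> turns the factor
    \<open>2 * k\<close> into \<open>2 * k * (2 / e)\<close>.\<close>
  define c where "c = 4 * k / e"
  have bound: "cmod (ip (M x) y) \<le> c * nrm x * nrm (Na y)" for x y
  proof (cases "x = 0")
    case False
    then have x: "nrm x > 0" by (simp add: order_less_le)
    define t where "t = e / (2 * nrm x)"
    have t: "t > 0" using e x by (simp add: t_def)
    have "nrm (of_real t *s x) < e" using e x t by (simp only: nrm_scale norm_of_real) (simp add: t_def)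
    from near[OF this, of y] have "t * cmod (ip (M x) y) \<le> 2 * k * nrm (Na y)"
      using t by (simp add: bops_scale[OF M] ip_simps norm_mult)
    then have "cmod (ip (M x) y) \<le> 2 * k * nrm (Na y) / t"
      using t by (simp add: field_simps)
    also have "\<dots> = c * nrm x * nrm (Na y)"
      using e x by (simp add: t_def c_def field_simps)
    finally show ?thesis .
  qed (use M in simp)
  have sub: "subspace (range Na)"
    using Na(1) by (auto simp: subspace_def simp flip: bops_add bops_scale)
      (metis bops_zero rangeI)
  \<comment> \<open>Solutions are sought in the closure of the range of the adjoint, the orthogonal
    complement of the kernel of \<open>N\<close>. They are unique there, which makes the choice
    \<open>Z\<close> linear.\<close>
  define V where "V = metric.mtopology closure_of (range Na)"
  note V = closure_subspace[OF sub, folded V_def]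
  have uniq: "w = w'" if "w \<in> V" "w' \<in> V" "N w = N w'" for w w'
  proof -
    have d: "w - w' \<in> V" using V(1) that by (intro subspace_diff)
    then obtain X where X: "\<And>n. X n \<in> range Na" "converges X (w - w')" using V(4) by blast
    have "ip (w - w') (X n) = 0" for n
      using X(1)[of n] that(3) by (auto simp: bops_diff[OF N] simp flip: Na(2))
    then have "ip (w - w') (w - w') = 0"
      using tendsto_ip_right[OF X(2), of "w - w'"] by (simp add: LIMSEQ_const_iff)
    then show ?thesis using ip_pos[of "w - w'"] by auto
  qed
  \<comment> \<open>Projecting any solution to \<open>V\<close> removes a vector orthogonal to the
    range of \<open>Na\<close>, which \<open>N\<close> maps to zero.\<close>
  have "\<exists>w\<in>V. N w = M x" for x
  proof -
    obtain z where z: "M x = N z" using range by auto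
    have "ip (N (z - proj V z)) y = 0" for y
      using proj_orthogonal[OF V(1,2), of "Na y" z] V(3) by (auto simp: Na(2))
    then have "N (z - proj V z) = 0" using ip_eq_imp_eq[of _ 0] by simp
    then show ?thesis using proj_in[OF V(1,2), of z] z by (auto simp: bops_diff[OF N])
  qed
  then obtain Z where Z: "\<And>x. Z x \<in> V" "\<And>x. N (Z x) = M x" by metis
  have "Z \<in> bops"
  proof (rule bopsI[where K = c])
    show "Z (x + y) = Z x + Z y" for x y
      by (rule uniq[OF Z(1) subspace_add[OF V(1) Z(1) Z(1)]])
        (simp add: Z bops_add[OF N] bops_add[OF M])
    show "Z (a *s x) = a *s Z x" for a x
      by (rule uniq[OF Z(1) subspace_scale[OF V(1) Z(1)]])
        (simp add: Z bops_scale[OF N] bops_scale[OF M])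
    show "nrm (Z x) \<le> c * nrm x" for x
    proof (cases "Z x = 0")
      case True
      have "c \<ge> 0" using e by (simp add: c_def)
      with True show ?thesis by simp
    next
      case False
      obtain X where X: "\<And>n. X n \<in> range Na" "converges X (Z x)" using V(4) Z(1) by blast
      \<comment> \<open>For \<open>X n = Na y\<close> the left side is
        \<open>cmod (ip (M x) y)\<close>, so the Baire estimate applies; letting \<open>X n\<close>
        tend to \<open>Z x\<close> gives the norm bound.\<close>
      have "cmod (ip (Z x) (X n)) \<le> c * nrm x * nrm (X n)" for n
        using X(1)[of n] bound[of x] by (auto simp: Z(2) simp flip: Na(2))
      moreover have "(\<lambda>n. cmod (ip (Z x) (X n))) \<longlonglongrightarrow> cmod (ip (Z x) (Z x))"
        by (intro tendsto_norm tendsto_ip_right X)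
      moreover have "(\<lambda>n. c * nrm x * nrm (X n)) \<longlonglongrightarrow> c * nrm x * nrm (Z x)"
        by (intro tendsto_mult tendsto_const tendsto_nrm X)
      ultimately have "cmod (ip (Z x) (Z x)) \<le> c * nrm x * nrm (Z x)"
        by (intro LIMSEQ_le) auto
      then have "nrm (Z x) * nrm (Z x) \<le> c * nrm x * nrm (Z x)"
        by (simp add: ip_self power2_eq_square norm_mult)
      moreover have "nrm (Z x) > 0" using False by (simp add: order_less_le)
      ultimately show ?thesis by simp
    qed
  qed
  with Z(2) show ?thesis by blast
qed

end

subsection \<open>Krein spaces\<close>

context decomposed_krein_space
begin

section \<open>The Hilbert space attached to the fundamental decomposition\<close>

lemma subspace_Hp: "subspace Hp" and subspace_Hm: "subspace Hm"
  and Hp_pos: "x \<in> Hp \<Longrightarrow> x \<noteq> 0 \<Longrightarrow> 0 < ip x x"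
  and Hm_neg: "x \<in> Hm \<Longrightarrow> x \<noteq> 0 \<Longrightarrow> 0 < - ip x x"
  and Hp_Hm_orth: "x \<in> Hp \<Longrightarrow> y \<in> Hm \<Longrightarrow> ip x y = 0"
  using fundamental_decomposition
  by (auto simp: fundamental_decomposition_def hilbert_subspace_def orthogonal_sets_def)

lemma ex1_pos_part: "\<exists>!p. p \<in> Hp \<and> x - p \<in> Hm"
proof -
  have "x \<in> Hp + Hm" and int: "Hp \<inter> Hm = {0}"
    using fundamental_decomposition by (auto simp: fundamental_decomposition_def direct_sum_def)
  then obtain p n where "p \<in> Hp" "n \<in> Hm" "x = p + n" by (auto elim: set_plus_elim)
  moreover have "p = q" if p: "p \<in> Hp" "x - p \<in> Hm" and q: "q \<in> Hp" "x - q \<in> Hm" for p q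
  proof -
    have "p - q \<in> Hp" using subspace_Hp p q by (simp add: subspace_diff)
    moreover have "p - q \<in> Hm" using subspace_diff[OF subspace_Hm q(2) p(2)] by simp
    ultimately have "p - q \<in> Hp \<inter> Hm" by blast
    then show ?thesis unfolding int by simp
  qed
  ultimately show ?thesis by (metis add_diff_cancel_left')
qed

lemma pos_part_in: "pos_part x \<in> Hp" and neg_part_in: "neg_part x \<in> Hm"
  using theI'[OF ex1_pos_part[of x]] unfolding pos_part_def neg_part_def by blast+

lemma pos_part_eqI: "p \<in> Hp \<Longrightarrow> x - p \<in> Hm \<Longrightarrow> pos_part x = p"
  using ex1_pos_part[of x] pos_part_in[of x] neg_part_in[of x] unfolding neg_part_def by blast

lemma pos_neg_part: "x = pos_part x + neg_part x"
  by (simp add: neg_part_def)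

lemma pos_part_add: "pos_part (x + y) = pos_part x + pos_part y"
proof (rule pos_part_eqI)
  have "neg_part x + neg_part y \<in> Hm"
    using subspace_Hm neg_part_in by (simp add: subspace_add)
  then show "x + y - (pos_part x + pos_part y) \<in> Hm"
    by (simp add: neg_part_def algebra_simps)
qed (use subspace_Hp pos_part_in in \<open>simp add: subspace_add\<close>)

lemma neg_part_add: "neg_part (x + y) = neg_part x + neg_part y"
  by (simp add: neg_part_def pos_part_add)

lemma pos_part_scale: "pos_part (c *s x) = c *s pos_part x"
proof (rule pos_part_eqI)
  have "c *s neg_part x \<in> Hm"
    using subspace_Hm neg_part_in by (simp add: subspace_scale)
  then show "c *s x - c *s pos_part x \<in> Hm"
    by (simp add: neg_part_def scale_right_diff_distrib)
qed (use subspace_Hp pos_part_in in \<open>simp add: subspace_scale\<close>)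

lemma neg_part_scale: "neg_part (c *s x) = c *s neg_part x"
  by (simp add: neg_part_def pos_part_scale scale_right_diff_distrib)

lemma pos_part_Hp: "x \<in> Hp \<Longrightarrow> pos_part x = x"
  by (rule pos_part_eqI) (simp_all add: subspace_0[OF subspace_Hm])

lemma pos_part_Hm: "x \<in> Hm \<Longrightarrow> pos_part x = 0"
  by (rule pos_part_eqI) (simp_all add: subspace_0[OF subspace_Hp])

lemma neg_part_Hp: "x \<in> Hp \<Longrightarrow> neg_part x = 0"
  by (simp add: neg_part_def pos_part_Hp)

lemma neg_part_Hm: "x \<in> Hm \<Longrightarrow> neg_part x = x"
  by (simp add: neg_part_def pos_part_Hm)

lemma ip_pos_neg: "ip (pos_part x) (neg_part y) = 0" "ip (neg_part y) (pos_part x) = 0"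
  using Hp_Hm_orth[OF pos_part_in[of x] neg_part_in[of y]] ip_eq_0_commute by auto

sublocale H: inner_form scale hip
proof unfold_locales
  fix x y z c
  show "hip (x + y) z = hip x z + hip y z"
    by (simp add: hip_def pos_part_add neg_part_add ip_simps)
  show "hip (c *s x) y = c * hip x y"
    by (simp add: hip_def pos_part_scale neg_part_scale ip_simps algebra_simps)
  show "hip y x = cnj (hip x y)"
    by (simp add: hip_def flip: ip_hermitian)
  show "0 < hip x x" if "x \<noteq> 0"
  proof -
    have "0 \<le> ip (pos_part x) (pos_part x)" "pos_part x \<noteq> 0 \<Longrightarrow> 0 < ip (pos_part x) (pos_part x)"
      "0 \<le> - ip (neg_part x) (neg_part x)" "neg_part x \<noteq> 0 \<Longrightarrow> 0 < - ip (neg_part x) (neg_part x)"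
      using Hp_pos[OF pos_part_in] Hm_neg[OF neg_part_in]
      by (cases "pos_part x = 0"; cases "neg_part x = 0"; fastforce intro: less_imp_le)+
    moreover have "pos_part x \<noteq> 0 \<or> neg_part x \<noteq> 0"
      using that pos_neg_part[of x] by auto
    ultimately show ?thesis
      unfolding hip_def diff_conv_add_uminus by (auto intro: add_pos_nonneg add_nonneg_pos)
  qed
qed

lemma hip_Hp: "x \<in> Hp \<Longrightarrow> hip x x = ip x x"
  by (simp add: hip_def pos_part_Hp neg_part_Hp)

lemma hip_Hm: "x \<in> Hm \<Longrightarrow> hip x x = - ip x x"
  by (simp add: hip_def pos_part_Hm neg_part_Hm)

lemma nrm_split: "(H.nrm x)\<^sup>2 = (H.nrm (pos_part x))\<^sup>2 + (H.nrm (neg_part x))\<^sup>2"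
proof -
  have "hip x x = hip (pos_part x) (pos_part x) + hip (neg_part x) (neg_part x)"
    by (simp add: hip_Hp hip_Hm pos_part_in neg_part_in) (simp add: hip_def)
  then show ?thesis by (simp add: H.Re_ip_self[symmetric])
qed

lemma nrm_pos_part_le: "H.nrm (pos_part x) \<le> H.nrm x"
  and nrm_neg_part_le: "H.nrm (neg_part x) \<le> H.nrm x"
  by (rule power2_le_imp_le; use nrm_split[of x] in simp)+

text \<open>Completeness of \<open>Hp\<close> and \<open>Hm\<close> is given in the metric of
  \<open>ip\<close> or its negative on the subspace; this moves it to the norm of
  \<open>hip\<close>, with which that metric agrees on \<open>S\<close>.\<close>

lemma hilbert_subspace_converges:
  assumes S: "hilbert_subspace f S" and f: "\<And>x. x \<in> S \<Longrightarrow> f x x = hip x x"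
    and f_minus: "\<And>x. f (- x) (- x) = f x x"
    and X: "\<And>n. X n \<in> S" and cauchy: "\<And>e. 0 < e \<Longrightarrow> \<exists>N. \<forall>n n'. N \<le> n \<longrightarrow> N \<le> n' \<longrightarrow> H.nrm (X n - X n') < e"
  shows "\<exists>l. H.converges X l"
proof -
  have sub: "subspace S" using S by (simp add: hilbert_subspace_def)
  \<comment> \<open>\<open>Metric_space\<close> asks for symmetry on the whole type, also outside
    \<open>S\<close>; \<open>f_minus\<close> supplies it.\<close>
  have commute: "form_dist f x y = form_dist f y x" for x y
    using f_minus[of "x - y"] by (simp add: form_dist_def)
  have dist: "form_dist f x y = H.nrm (x - y)" if "x \<in> S" "y \<in> S" for x y
    using that sub f[of "x - y"] H.form_dist_eq_nrm[of x y]
    by (simp add: form_dist_def subspace_diff)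
  interpret S: Metric_space S "form_dist f"
  proof
    show "form_dist f x y = 0 \<longleftrightarrow> x = y" if "x \<in> S" "y \<in> S" for x y
      using that by (simp add: dist)
    show "form_dist f x z \<le> form_dist f x y + form_dist f y z"
      if "x \<in> S" "y \<in> S" "z \<in> S" for x y z
      using that H.nrm_triangle_diff by (simp add: dist)
  qed (simp add: form_dist_def, rule commute)
  have "S.MCauchy X"
    using X cauchy by (auto simp: S.MCauchy_def dist)
  moreover have "S.mcomplete" using S by (simp add: hilbert_subspace_def)
  ultimately obtain l where "limitin S.mtopology X l sequentially"
    by (auto simp: S.mcomplete_def)
  then show ?thesis
    using X by (auto simp: S.limitin_metric_dist_null H.converges_def dist)
qed

text \<open>Both components of a Cauchy sequence are Cauchy, because passing to a component does not
  increase the norm; the limits of the components add up.\<close>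

sublocale H: hilbert_form scale hip
proof unfold_locales
  show "H.metric.mcomplete"
    unfolding H.metric.mcomplete_def
  proof (intro allI impI)
    fix X assume "H.metric.MCauchy X"
    then have X: "\<exists>N. \<forall>n n'. N \<le> n \<longrightarrow> N \<le> n' \<longrightarrow> H.nrm (X n - X n') < e" if "0 < e" for e
      using that by (simp add: H.metric.MCauchy_def H.form_dist_eq_nrm)
    have fd: "hilbert_subspace ip Hp" "hilbert_subspace (\<lambda>x y. - ip x y) Hm"
      using fundamental_decomposition by (auto simp: fundamental_decomposition_def)
    have diff: "pos_part (x - y) = pos_part x - pos_part y" "neg_part (x - y) = neg_part x - neg_part y"
      for x y
      using pos_part_add[of "x - y" y] neg_part_add[of "x - y" y] by simp_all
    have le: "H.nrm (pos_part x - pos_part y) \<le> H.nrm (x - y)"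
      "H.nrm (neg_part x - neg_part y) \<le> H.nrm (x - y)" for x y
      using nrm_pos_part_le nrm_neg_part_le by (simp_all flip: diff)
    obtain p where p: "H.converges (\<lambda>n. pos_part (X n)) p"
      using hilbert_subspace_converges[of ip Hp "\<lambda>n. pos_part (X n)"] X le_less_trans[OF le(1)] fd(1)
      by (simp add: hip_Hp pos_part_in) meson
    obtain q where q: "H.converges (\<lambda>n. neg_part (X n)) q"
      using hilbert_subspace_converges[of "\<lambda>x y. - ip x y" Hm "\<lambda>n. neg_part (X n)"] X
        le_less_trans[OF le(2)] fd(2)
      by (simp add: hip_Hm neg_part_in) meson
    have "H.converges X (p + q)"
      using H.converges_add[OF p q] by (simp flip: pos_neg_part)
    then show "\<exists>l. limitin H.metric.mtopology X l sequentially"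
      unfolding H.limitin_iff_converges by blast
  qed
qed

lemma hnorm_eq_nrm: "hnorm = H.nrm"
  by (simp add: fun_eq_iff hnorm_def H.nrm_def)

lemma bounded_ops_eq_bops: "bounded_ops = H.bops"
  by (simp add: bounded_ops_def H.bops_def hnorm_eq_nrm)

lemma orth_proj_eq_proj: "orth_proj = H.proj"
  by (simp add: fun_eq_iff orth_proj_def H.proj_def)

section \<open>The fundamental symmetry and the Krein space adjoint\<close>

definition J :: "'a \<Rightarrow> 'a" where
  "J x = pos_part x - neg_part x"

lemma pos_part_J: "pos_part (J x) = pos_part x" and neg_part_J: "neg_part (J x) = - neg_part x"
proof -
  have "- neg_part x \<in> Hm" using subspace_Hm neg_part_in by (simp add: subspace_neg)
  then show "pos_part (J x) = pos_part x"
    by (intro pos_part_eqI pos_part_in) (simp add: J_def)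
  then show "neg_part (J x) = - neg_part x"
    by (simp add: neg_part_def[of "J x"]) (simp add: J_def)
qed

lemma J_J [simp]: "J (J x) = x"
  by (simp add: J_def[of "J x"] pos_part_J neg_part_J flip: pos_neg_part)

lemma ip_J_left: "ip (J x) y = hip x y"
proof -
  have "ip (J x) y = ip (J x) (pos_part y + neg_part y)" by (simp flip: pos_neg_part)
  then show ?thesis by (simp add: J_def ip_simps ip_pos_neg hip_def)
qed

lemma hip_J_left: "hip (J x) y = ip x y"
  using ip_J_left[of "J x" y] by simp

lemma hip_J_right: "hip x (J y) = ip x y"
  by (metis H.ip_hermitian hip_J_left ip_hermitian)

lemma ip_J_right: "ip x (J y) = hip x y"
  using hip_J_right[of x "J y"] by simp

lemma nrm_J: "H.nrm (J x) = H.nrm x"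
proof -
  have "(H.nrm (J x))\<^sup>2 = (H.nrm x)\<^sup>2"
    using H.Re_ip_self[of "J x"] H.Re_ip_self[of x] by (simp add: hip_J_left ip_J_right)
  then show ?thesis by simp
qed

lemma J_bops: "J \<in> H.bops"
proof (rule H.bopsI[where K = 1])
  show "J (x + y) = J x + J y" for x y
    by (simp add: J_def pos_part_add neg_part_add)
  show "J (c *s x) = c *s J x" for c x
    by (simp add: J_def pos_part_scale neg_part_scale scale_right_diff_distrib)
qed (simp add: nrm_J)

lemma J_selfadjoint: "H.selfadjoint J"
  by (simp add: H.selfadjoint_def hip_J_left hip_J_right)

text \<open>Inherited from the definite form \<open>hip\<close> through the bijection
  \<open>J\<close>.\<close>

lemma ip_right_eq_imp_eq: "(\<And>x. ip x u = ip x v) \<Longrightarrow> u = v"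
  by (metis H.ip_eq_imp_eq H.ip_hermitian hip_J_left J_J)

text \<open>Conjugating the Hilbert adjoint by \<open>J\<close> gives the adjoint for
  \<open>ip\<close>; nondegeneracy makes it the only candidate in the definition of
  \<open>adj\<close>.\<close>

lemma adj:
  assumes T: "T \<in> H.bops"
  shows "adj T \<in> H.bops" "ip (T x) y = ip x (adj T y)"
proof -
  obtain S where S: "S \<in> H.bops" "\<And>x y. hip (T x) y = hip x (S y)"
    using H.ex_adjoint[OF T] by blast
  define A where "A = (\<lambda>y. J (S (J y)))"
  have A: "A \<in> H.bops"
    unfolding A_def by (rule H.bops_compose[OF J_bops H.bops_compose[OF S(1) J_bops]])
  have ipA: "ip (T x) y = ip x (A y)" for x y
    by (simp add: A_def ip_J_right flip: S(2) hip_J_right)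
  have "\<exists>!S. S \<in> bounded_ops \<and> (\<forall>x y. ip (T x) y = ip x (S y))"
  proof (rule ex1I[of _ A])
    fix S assume "S \<in> bounded_ops \<and> (\<forall>x y. ip (T x) y = ip x (S y))"
    then show "S = A" using ipA by (intro ext ip_right_eq_imp_eq) metis
  qed (use A ipA in \<open>simp add: bounded_ops_eq_bops\<close>)
  from theI'[OF this, folded adj_def] show "adj T \<in> H.bops" "ip (T x) y = ip x (adj T y)"
    unfolding bounded_ops_eq_bops by blast+
qed

section \<open>The order on Gram operators and its first-order conditions\<close>

lemma ip_gram: "T \<in> H.bops \<Longrightarrow> ip (gram T x) x = ip (T x) (T x)"
  unfolding gram_def comp_apply by (metis adj(2) ip_hermitian)

text \<open>Since \<open>ip (gram T x) x\<close> is the real number \<open>ip (T x) (T x)\<close>,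
  the operator order reduces to comparing quadratic values vector by vector.\<close>

lemma op_le_gram:
  assumes "S \<in> H.bops" "T \<in> H.bops"
  shows "op_le (gram S) (gram T) \<longleftrightarrow> (\<forall>x. Re (ip (S x) (S x)) \<le> Re (ip (T x) (T x)))"
proof -
  have "0 \<le> ip (gram T x - gram S x) x \<longleftrightarrow> Re (ip (S x) (S x)) \<le> Re (ip (T x) (T x))" for x
  proof -
    have "ip (gram T x - gram S x) x = complex_of_real (Re (ip (T x) (T x)) - Re (ip (S x) (S x)))"
      using ip_self_real[of "T x"] ip_self_real[of "S x"] by (simp add: ip_diff_left ip_gram assms)
    then show ?thesis by (simp add: less_eq_complex_def)
  qed
  then show ?thesis by (simp add: op_le_def)
qed

text \<open>Perturbing \<open>S\<close> by \<open>L \<circ> K\<close> with \<open>K\<close> of rank one moves \<open>S x\<close> in any prescribed direction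
  of \<open>range L\<close>.\<close>

lemma ex_perturbation:
  assumes "x \<noteq> 0"
  shows "\<exists>K\<in>H.bops. K x = z"
proof
  show "(\<lambda>u. hip u x *s ((1 / hip x x) *s z)) \<in> H.bops" by (rule H.bops_rank_one)
  show "hip x x *s ((1 / hip x x) *s z) = z" using H.ip_pos[OF assms] by auto
qed

text \<open>Read at the single vector \<open>x\<close>, operator minimality becomes scalar
  minimality along \<open>S x + c *s s\<close>, since \<open>K x\<close> can be prescribed.\<close>

lemma gram_minimal_orthogonal:
  assumes S: "S \<in> H.bops" and L: "L \<in> H.bops" and s: "s \<in> range L"
    and min: "\<And>K. K \<in> H.bops \<Longrightarrow> op_le (gram S) (gram (\<lambda>x. S x + L (K x)))"
  shows "ip (S x) s = 0"
proof (cases "x = 0")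
  case False
  obtain z where z: "s = L z" using s by blast
  show ?thesis
  proof (rule ip_zero_if_minimal)
    fix c
    obtain K where K: "K \<in> H.bops" "K x = c *s z" using ex_perturbation[OF False] by blast
    have SLK: "(\<lambda>x. S x + L (K x)) \<in> H.bops" by (rule H.bops_sum[OF S H.bops_compose[OF L K(1)]])
    then show "Re (ip (S x) (S x)) \<le> Re (ip (S x + c *s s) (S x + c *s s))"
      using min[OF K(1)] K(2) unfolding op_le_gram[OF S SLK]
      by (auto simp: z H.bops_scale[OF L] dest!: spec[of _ x])
  qed
qed (use S in simp)

lemma gram_maximal_orthogonal:
  assumes S: "S \<in> H.bops" and L: "L \<in> H.bops" and s: "s \<in> range L"
    and max: "\<And>K. K \<in> H.bops \<Longrightarrow> op_le (gram (\<lambda>x. S x + L (K x))) (gram S)"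
  shows "ip (S x) s = 0"
proof (cases "x = 0")
  case False
  obtain z where z: "s = L z" using s by blast
  show ?thesis
  proof (rule ip_zero_if_maximal)
    fix c
    obtain K where K: "K \<in> H.bops" "K x = c *s z" using ex_perturbation[OF False] by blast
    have SLK: "(\<lambda>x. S x + L (K x)) \<in> H.bops" by (rule H.bops_sum[OF S H.bops_compose[OF L K(1)]])
    then show "Re (ip (S x + c *s s) (S x + c *s s)) \<le> Re (ip (S x) (S x))"
      using max[OF K(1)] K(2) unfolding op_le_gram[OF SLK S]
      by (auto simp: z H.bops_scale[OF L] dest!: spec[of _ x])
  qed
qed (use S in simp)

text \<open>\<open>J\<close> is a selfadjoint isometry for \<open>hip\<close> with
  \<open>hip (J x) x = ip x x\<close>, so splitting by the sign of \<open>J\<close> is splitting by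
  the sign of \<open>ip\<close>.\<close>

lemma sign_decomposition_exists:
  assumes "subspace R" "closed_set R"
  shows "\<exists>Sp Sm. sign_decomposition R Sp Sm"
proof -
  obtain Sp Sm where S: "subspace Sp" "closedin H.metric.mtopology Sp"
    "subspace Sm" "closedin H.metric.mtopology Sm" "direct_sum R Sp Sm"
    "\<And>x y. x \<in> Sp \<Longrightarrow> y \<in> Sm \<Longrightarrow> hip x y = 0" "\<And>x y. x \<in> Sp \<Longrightarrow> y \<in> Sm \<Longrightarrow> hip (J x) y = 0"
    "\<And>x. x \<in> Sp \<Longrightarrow> x \<noteq> 0 \<Longrightarrow> 0 < Re (hip (J x) x)" "\<And>x. x \<in> Sm \<Longrightarrow> Re (hip (J x) x) \<le> 0"
    by (rule H.ex_sign_decomposition[OF assms(1) _ J_bops _ J_selfadjoint])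
      (use assms(2) nrm_J in \<open>auto simp: closed_set_def\<close>)
  have "0 < ip x x" if "x \<in> Sp" "x \<noteq> 0" for x
    using S(8)[OF that] by (subst ip_self_real) (simp add: hip_J_left less_complex_def)
  moreover have "ip x x \<le> 0" if "x \<in> Sm" for x
    using S(9)[OF that] by (subst ip_self_real) (simp add: hip_J_left less_eq_complex_def)
  ultimately have "sign_decomposition R Sp Sm"
    using S unfolding hip_J_left
    by (simp add: sign_decomposition_def orthogonal_sets_def closed_set_def
        positive_subspace_def nonpositive_subspace_def)
  then show ?thesis by blast
qed

section \<open>The min-max problem for a fixed sign decomposition\<close>

context
  fixes B C :: "'a \<Rightarrow> 'a" and Sp Sm :: "'a set"
  assumes B: "B \<in> H.bops" and C: "C \<in> H.bops"
    and sign: "sign_decomposition (range B) Sp Sm"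
begin

private abbreviation Bp where "Bp \<equiv> orth_proj Sp \<circ> B"
private abbreviation Bm where "Bm \<equiv> orth_proj Sm \<circ> B"

lemma sign_subspaces:
  "subspace Sp" "closedin H.metric.mtopology Sp" "subspace Sm" "closedin H.metric.mtopology Sm"
  "range B = Sp + Sm"
  using sign by (auto simp: sign_decomposition_def positive_subspace_def nonpositive_subspace_def
      closed_set_def direct_sum_def)

lemma sign_orthogonal:
  assumes "x \<in> Sp" "y \<in> Sm" shows "ip x y = 0" "ip y x = 0" "hip x y = 0" "hip y x = 0"
  using assms sign ip_eq_0_commute H.ip_eq_0_commute
  by (auto simp: sign_decomposition_def orthogonal_sets_def)

lemma sign_Re_nonneg: "x \<in> Sp \<Longrightarrow> 0 \<le> Re (ip x x)"
  using sign by (cases "x = 0")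
    (auto simp: sign_decomposition_def positive_subspace_def less_complex_def)

lemma sign_Re_nonpos: "x \<in> Sm \<Longrightarrow> Re (ip x x) \<le> 0"
  using sign by (auto simp: sign_decomposition_def nonpositive_subspace_def less_eq_complex_def)

lemma Sp_definite: "x \<in> Sp \<Longrightarrow> ip x x = 0 \<Longrightarrow> x = 0"
  using sign by (auto simp: sign_decomposition_def positive_subspace_def)

lemma proj_sum:
  assumes "a \<in> Sp" "b \<in> Sm"
  shows "orth_proj Sp (a + b) = a" "orth_proj Sm (a + b) = b"
  unfolding orth_proj_eq_proj
  using assms sign_orthogonal by (auto intro!: H.proj_eqI sign_subspaces)

lemma Bp_plus_Bm: "Bp x + Bm x = B x"
proof -
  have "B x \<in> Sp + Sm" using sign_subspaces(5) by blast
  then obtain a b where "a \<in> Sp" "b \<in> Sm" "B x = a + b" by (rule set_plus_elim)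
  then show ?thesis by (simp add: proj_sum)
qed

lemma Bp_in: "Bp x \<in> Sp" and Bm_in: "Bm x \<in> Sm"
  by (simp_all add: orth_proj_eq_proj H.proj_in sign_subspaces)

text \<open>Each vector of \<open>Sp\<close> is some \<open>B z\<close>, and the projection returns
  it unchanged; so variations through \<open>Bp\<close> reach all of \<open>Sp\<close>.\<close>

lemma Sp_subset_range: "Sp \<subseteq> range Bp"
proof
  fix s assume s: "s \<in> Sp"
  then have "s + 0 \<in> Sp + Sm" using subspace_0[OF sign_subspaces(3)] by (rule set_plus_intro)
  then obtain z where "B z = s + 0" using sign_subspaces(5) by (metis rangeE)
  then have "Bp z = s" using proj_sum(1)[OF s subspace_0[OF sign_subspaces(3)]] by simp
  then show "s \<in> range Bp" by blast
qed

lemma Sm_subset_range: "Sm \<subseteq> range Bm"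
proof
  fix s assume s: "s \<in> Sm"
  with subspace_0[OF sign_subspaces(1)] have "0 + s \<in> Sp + Sm" by (rule set_plus_intro)
  then obtain z where "B z = 0 + s" using sign_subspaces(5) by (metis rangeE)
  then have "Bm z = s" using proj_sum(2)[OF subspace_0[OF sign_subspaces(1)] s] by simp
  then show "s \<in> range Bm" by blast
qed

lemma Bp_bops: "Bp \<in> H.bops" and Bm_bops: "Bm \<in> H.bops"
  unfolding comp_def orth_proj_eq_proj
  by (rule H.bops_compose[OF H.proj_bops B]; rule sign_subspaces)+

lemma residual_bops: "X \<in> H.bops \<Longrightarrow> Y \<in> H.bops \<Longrightarrow> residual Bp Bm C X Y \<in> H.bops"
  unfolding residual_def
  by (intro H.bops_diff_op H.bops_sum H.bops_compose[OF Bp_bops] H.bops_compose[OF Bm_bops] C)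

text \<open>Necessity: the inner minima and the outer maximum force the residual at an optimal pair
  to be orthogonal to both \<open>Sp\<close> and \<open>Sm\<close>, and \<open>C x\<close> is a
  point of \<open>range B\<close> minus that residual.\<close>

lemma range_C_if_max_min:
  assumes min: "\<And>Y. Y \<in> H.bops \<Longrightarrow>
      is_op_min ((\<lambda>X. gram (residual Bp Bm C X Y)) ` H.bops) (m Y)"
    and max: "is_op_max (m ` H.bops) M"
  shows "range C \<subseteq> range B + orth_companion (range B)"
proof -
  let ?r = "residual Bp Bm C"
  have "\<exists>X\<in>H.bops. m Y = gram (?r X Y)" if "Y \<in> H.bops" for Y
    using min[OF that] by (auto simp: is_op_min_def)
  then obtain X where X: "\<And>Y. Y \<in> H.bops \<Longrightarrow> X Y \<in> H.bops"
    "\<And>Y. Y \<in> H.bops \<Longrightarrow> m Y = gram (?r (X Y) Y)" by metis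
  have orth_p: "ip (?r (X Y) Y x) s = 0" if Y: "Y \<in> H.bops" and s: "s \<in> Sp" for Y x s
  proof (rule gram_minimal_orthogonal[OF residual_bops[OF X(1)[OF Y] Y] Bp_bops])
    show "s \<in> range Bp" using Sp_subset_range s by blast
    fix K assume K: "K \<in> H.bops"
    have "op_le (m Y) (gram (?r (\<lambda>x. X Y x + K x) Y))"
      using min[OF Y] H.bops_sum[OF X(1)[OF Y] K] by (auto simp: is_op_min_def)
    moreover have "?r (\<lambda>x. X Y x + K x) Y = (\<lambda>x. ?r (X Y) Y x + Bp (K x))"
      by (simp only: residual_def H.bops_add[OF Bp_bops]) (simp add: fun_eq_iff algebra_simps)
    ultimately show "op_le (gram (?r (X Y) Y)) (gram (\<lambda>x. ?r (X Y) Y x + Bp (K x)))"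
      using X(2)[OF Y] by simp
  qed
  \<comment> \<open>Both residuals are orthogonal to \<open>Sp\<close>, and so are the
    \<open>Bm\<close> terms; hence \<open>d\<close> in \<open>Sp\<close> is orthogonal to itself and
    vanishes by positivity.\<close>
  have Bp_X: "Bp (X Y x) = Bp (X Y' x)" if Y: "Y \<in> H.bops" and Y': "Y' \<in> H.bops" for Y Y' x
  proof -
    define d where "d = Bp (X Y x) - Bp (X Y' x)"
    have d: "d \<in> Sp" unfolding d_def by (rule subspace_diff[OF sign_subspaces(1) Bp_in Bp_in])
    have "d = ?r (X Y) Y x - ?r (X Y') Y' x - (Bm (Y x) - Bm (Y' x))"
      by (simp only: d_def residual_def) (simp add: algebra_simps)
    then have "ip d d = ip (?r (X Y) Y x) d - ip (?r (X Y') Y' x) d - (ip (Bm (Y x)) d - ip (Bm (Y' x)) d)"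
      by (metis ip_diff_left)
    then have "ip d d = 0"
      using orth_p[OF Y d] orth_p[OF Y' d] sign_orthogonal(2)[OF d Bm_in] by simp
    then have "d = 0" using Sp_definite d by blast
    then show ?thesis by (simp add: d_def)
  qed
  obtain Y where Y: "Y \<in> H.bops" "M = m Y" using max by (auto simp: is_op_max_def)
  have orth_m: "ip (?r (X Y) Y x) s = 0" if s: "s \<in> Sm" for x s
  proof (rule gram_maximal_orthogonal[OF residual_bops[OF X(1)[OF Y(1)] Y(1)] Bm_bops])
    show "s \<in> range Bm" using Sm_subset_range s by blast
    fix K assume K: "K \<in> H.bops"
    let ?Y = "\<lambda>x. Y x + K x"
    have Y': "?Y \<in> H.bops" by (rule H.bops_sum[OF Y(1) K])
    have "op_le (m ?Y) (m Y)"
      using max Y' Y(2) by (auto simp: is_op_max_def)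
    \<comment> \<open>The minimiser may change with \<open>Y\<close>, but its image under
      \<open>Bp\<close> does not, so the residual moves exactly by \<open>Bm (K x)\<close>.\<close>
    moreover have "?r (X ?Y) ?Y = (\<lambda>x. ?r (X Y) Y x + Bm (K x))"
      by (simp only: residual_def H.bops_add[OF Bm_bops] Bp_X[OF Y' Y(1)])
        (simp add: fun_eq_iff algebra_simps)
    ultimately show "op_le (gram (\<lambda>x. ?r (X Y) Y x + Bm (K x))) (gram (?r (X Y) Y))"
      using X(2)[OF Y(1)] X(2)[OF Y'] by simp
  qed
  have "C x \<in> range B + orth_companion (range B)" for x
  proof -
    have "Bp (X Y x) + Bm (Y x) \<in> range B"
      unfolding sign_subspaces(5) by (intro set_plus_intro Bp_in Bm_in)
    moreover have "- ?r (X Y) Y x \<in> orth_companion (range B)"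
      unfolding sign_subspaces(5) orth_companion_def
      using orth_p[OF Y(1)] orth_m by (auto simp: ip_simps elim!: set_plus_elim)
    ultimately have "(Bp (X Y x) + Bm (Y x)) + - ?r (X Y) Y x \<in> range B + orth_companion (range B)"
      by (rule set_plus_intro)
    then show ?thesis by (simp add: residual_def)
  qed
  then show ?thesis by blast
qed

text \<open>Sufficiency: the residual is an orthogonal sum of \<open>B (Z x) - C x\<close>, a vector
  of \<open>Sp\<close> governed by \<open>X\<close> and a vector of \<open>Sm\<close> governed by
  \<open>Y\<close>. The \<open>Sp\<close> term contributes a nonnegative value, zero at
  \<open>X = Z\<close>, and the \<open>Sm\<close> term a nonpositive one, zero at
  \<open>Y = Z\<close>.\<close>

lemma is_ImMS_if_normal_equation:
  assumes Z: "Z \<in> H.bops" and ortho: "\<And>x z. ip (B (Z x) - C x) (B z) = 0"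
  shows "is_ImMS B C Z"
proof -
  let ?r = "residual Bp Bm C"
  have res: "?r X Y x = (B (Z x) - C x) + (Bp (X x - Z x) + Bm (Y x - Z x))" for X Y x
  proof -
    have "?r X Y x = (Bp (Z x) + Bm (Z x) - C x) + ((Bp (X x) - Bp (Z x)) + (Bm (Y x) - Bm (Z x)))"
      by (simp only: residual_def) (simp add: algebra_simps)
    then show ?thesis
      by (simp only: Bp_plus_Bm H.bops_diff[OF Bp_bops] H.bops_diff[OF Bm_bops])
  qed
  have ortho': "ip (B (Z x) - C x) s = 0" if "s \<in> Sp + Sm" for s x
    using that ortho sign_subspaces(5) by (metis rangeE)
  have ortho_p: "ip (B (Z x) - C x) s = 0" if "s \<in> Sp" for s x
    using ortho'[OF set_plus_intro[OF that subspace_0[OF sign_subspaces(3)]]] by simp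
  have ortho_m: "ip (B (Z x) - C x) s = 0" if "s \<in> Sm" for s x
    using ortho'[OF set_plus_intro[OF subspace_0[OF sign_subspaces(1)] that]] by simp
  have pythagoras: "Re (ip (u + (p + q)) (u + (p + q))) = Re (ip u u) + (Re (ip p p) + Re (ip q q))"
    if "ip u p = 0" "ip u q = 0" "ip p q = 0" for u p q
    using that by (simp add: Re_ip_add_self ip_add_right[of u])
  have form: "Re (ip (?r X Y x) (?r X Y x)) = Re (ip (B (Z x) - C x) (B (Z x) - C x)) +
      (Re (ip (Bp (X x - Z x)) (Bp (X x - Z x))) + Re (ip (Bm (Y x - Z x)) (Bm (Y x - Z x))))" for X Y x
    unfolding res
    by (rule pythagoras[OF ortho_p[OF Bp_in] ortho_m[OF Bm_in] sign_orthogonal(1)[OF Bp_in Bm_in]])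
  have Bp0: "Bp 0 = 0" and Bm0: "Bm 0 = 0" using Bp_bops Bm_bops by (metis H.bops_zero)+
  \<comment> \<open>One and the same \<open>X = Z\<close> attains the inner minimum for every
    \<open>Y\<close>; this yields the witness for \<open>m\<close>.\<close>
  have min: "is_op_min ((\<lambda>X. gram (?r X Y)) ` bounded_ops) (gram (?r Z Y))" if Y: "Y \<in> bounded_ops" for Y
    unfolding is_op_min_def
  proof (intro conjI ballI imageI)
    show "Z \<in> bounded_ops" using Z by (simp add: bounded_ops_eq_bops)
    fix T assume "T \<in> (\<lambda>X. gram (?r X Y)) ` bounded_ops"
    then obtain X where X: "X \<in> bounded_ops" and T: "T = gram (?r X Y)" by blast
    have "Re (ip (?r Z Y x) (?r Z Y x)) \<le> Re (ip (?r X Y x) (?r X Y x))" for x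
      using sign_Re_nonneg[OF Bp_in, of "X x - Z x"] Bp0 unfolding form by simp
    then show "op_le (gram (?r Z Y)) T"
      using X Y Z unfolding T bounded_ops_eq_bops by (subst op_le_gram) (auto intro: residual_bops)
  qed
  have rZ: "?r Z Z = (\<lambda>x. B (Z x) - C x)"
    by (simp only: residual_def Bp_plus_Bm)
  have max: "is_op_max ((\<lambda>Y. gram (?r Z Y)) ` bounded_ops) (gram (\<lambda>x. B (Z x) - C x))"
    unfolding is_op_max_def
  proof (intro conjI ballI)
    show "gram (\<lambda>x. B (Z x) - C x) \<in> (\<lambda>Y. gram (?r Z Y)) ` bounded_ops"
      using Z unfolding rZ[symmetric] bounded_ops_eq_bops by blast
    fix T assume "T \<in> (\<lambda>Y. gram (?r Z Y)) ` bounded_ops"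
    then obtain Y where Y: "Y \<in> bounded_ops" and T: "T = gram (?r Z Y)" by blast
    have "Re (ip (?r Z Y x) (?r Z Y x)) \<le> Re (ip (?r Z Z x) (?r Z Z x))" for x
      using sign_Re_nonpos[OF Bm_in, of "Y x - Z x"] Bm0 unfolding form by simp
    then show "op_le T (gram (\<lambda>x. B (Z x) - C x))"
      using Y Z unfolding T rZ[symmetric] bounded_ops_eq_bops
      by (subst op_le_gram) (auto intro: residual_bops)
  qed
  show ?thesis
    unfolding is_ImMS_def
    by (intro conjI exI[of _ Sp] exI[of _ Sm] exI[of _ "\<lambda>Y. gram (?r Z Y)"] ballI)
      (use Z in \<open>simp add: bounded_ops_eq_bops\<close>, rule sign, erule min, rule max)
qed

end

text \<open>Applying \<open>adj B\<close> to a splitting \<open>C x = B z + p\<close> removes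
  \<open>p\<close>, so the normal equation is solvable for each \<open>x\<close>; Douglas'
  factorization turns the solutions into a bounded operator.\<close>

lemma ex_normal_equation:
  assumes B: "B \<in> H.bops" and C: "C \<in> H.bops"
    and range: "range C \<subseteq> range B + orth_companion (range B)"
  shows "\<exists>Z\<in>H.bops. \<forall>x z. ip (B (Z x) - C x) (B z) = 0"
proof -
  note aB = adj[OF B]
  have "adj B (C x) \<in> range (\<lambda>z. adj B (B z))" for x
  proof -
    have "C x \<in> range B + orth_companion (range B)" using range by blast
    then obtain z p where z: "C x = B z + p" and p: "p \<in> orth_companion (range B)"
      by (auto elim!: set_plus_elim)
    have "adj B p = 0"
    proof (rule ip_right_eq_imp_eq)
      show "ip y (adj B p) = ip y 0" for y
        using p ip_eq_0_commute[of p "B y"] by (simp add: orth_companion_def flip: aB(2))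
    qed
    then show ?thesis by (simp add: z H.bops_add[OF aB(1)])
  qed
  then obtain Z where Z: "Z \<in> H.bops" "\<And>x. adj B (B (Z x)) = adj B (C x)"
    using H.douglas[OF H.bops_compose[OF aB(1) C] H.bops_compose[OF aB(1) B]] by blast
  have "ip (B (Z x) - C x) (B z) = 0" for x z
  proof -
    have "ip (B z) (B (Z x) - C x) = 0"
      by (simp add: aB(2) H.bops_diff[OF aB(1)] Z(2))
    then show ?thesis using ip_eq_0_commute by blast
  qed
  with Z(1) show ?thesis by blast
qed

theorem ex_ImMS_iff:
  assumes B: "B \<in> closed_range_ops" and C: "C \<in> bounded_ops"
  shows "(\<exists>Z. is_ImMS B C Z) \<longleftrightarrow> range C \<subseteq> range B + orth_companion (range B)"
proof
  have B': "B \<in> H.bops" "closed_set (range B)"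
    using B by (auto simp: closed_range_ops_def bounded_ops_eq_bops)
  have C': "C \<in> H.bops" using C by (simp add: bounded_ops_eq_bops)
  {
    assume "\<exists>Z. is_ImMS B C Z"
    then obtain Z Sp Sm m where "sign_decomposition (range B) Sp Sm"
      "\<And>Y. Y \<in> H.bops \<Longrightarrow> is_op_min
         ((\<lambda>X. gram (residual (orth_proj Sp \<circ> B) (orth_proj Sm \<circ> B) C X Y)) ` H.bops) (m Y)"
      "is_op_max (m ` H.bops) (gram (\<lambda>x. B (Z x) - C x))"
      unfolding is_ImMS_def bounded_ops_eq_bops by blast
    then show "range C \<subseteq> range B + orth_companion (range B)"
      by (rule range_C_if_max_min[OF B'(1) C'])
  next
    assume "range C \<subseteq> range B + orth_companion (range B)"
    then obtain Z where Z: "Z \<in> H.bops" "\<And>x z. ip (B (Z x) - C x) (B z) = 0"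
      using ex_normal_equation[OF B'(1) C'] by blast
    have "subspace (range B)"
      using H.bops_add[OF B'(1), symmetric] H.bops_scale[OF B'(1), symmetric] H.bops_zero[OF B'(1)]
      unfolding subspace_def by (metis (mono_tags, lifting) rangeE rangeI)
    \<comment> \<open>Closedness of the range enters here: it provides the decomposition that
      \<open>is_ImMS\<close> asks for.\<close>
    then obtain Sp Sm where "sign_decomposition (range B) Sp Sm"
      using sign_decomposition_exists B'(2) by blast
    from is_ImMS_if_normal_equation[OF B'(1) C' this Z] show "\<exists>Z. is_ImMS B C Z" by blast
  }
qed

end

theorem corollary5p2:
  fixes scale :: "complex \<Rightarrow> 'a::ab_group_add \<Rightarrow> 'a"
    and ip :: "'a \<Rightarrow> 'a \<Rightarrow> complex"
    and Hp Hm :: "'a set"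
    and B C :: "'a \<Rightarrow> 'a"
  assumes "decomposed_krein_space scale ip Hp Hm"
    and "B \<in> decomposed_krein_space.closed_range_ops scale ip Hp Hm"
    and "C \<in> decomposed_krein_space.bounded_ops scale ip Hp Hm"
  shows "(\<exists>Z. decomposed_krein_space.is_ImMS scale ip Hp Hm B C Z) \<longleftrightarrow>
    range C \<subseteq> range B + hermitian_form.orth_companion ip (range B)"
  using assms by (rule decomposed_krein_space.ex_ImMS_iff)

end
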